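(* Let $C$ be a field of characteristic $0$, $q\in C$ a non-zero element that is not a root of unity, and let $R$ be the qsi algebra over $C$ and $M$ the qsi module defined in the context. Let $\mathcal{R}$ be a (not necessarily commutative) qsi algebra over $C$ satisfying the following conditions. (1) There exists a fundamental system of solutions $\mathbf{Y}\in M_2(\mathcal{R})$ for $M$, i.e. a matrix $\mathbf{Y}$ invertible in $M_2(\mathcal{R})$ with $$\sigma(\mathbf{Y})=\begin{bmatrix}q&0\\0&1\end{bmatrix}\mathbf{Y},\qquad \theta^{(1)}(\mathbf{Y})=\begin{bmatrix}0&1\\0&0\end{bmatrix}\mathbf{Y},$$ such that $\mathcal{R}$ is generated as a $C$-algebra by the entries of $\mathbf{Y}$ and $\mathbf{Y}^{-1}$. (2) The qsi algebra $\mathcal{R}$ is simple. (3) There exists a $C$-rational point of the abstract $C$-algebra $\mathcal{R}^\natural$, i.e. a $C$-algebra morphism $\mathcal{R}^{\natural}\to C$. Then the qsi algebra $\mathcal{R}$ is isomorphic over $C$ to $R$ (the Picard-Vessiot ring of $M$).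
   Context: A qsi algebra ($q$-skew iterative $\sigma$-differential algebra) over $C$ is an associative unital, possibly non-commutative, $C$-algebra $A$ with a $C$-algebra automorphism $\sigma$ and $C$-linear maps $\theta^{(i)}:A\to A$ ($i\in\mathbb{N}$) such that $\theta^{(0)}=\mathrm{Id}$, $\theta^{(i)}\sigma=q^i\sigma\theta^{(i)}$, $\theta^{(i)}(ab)=\sum_{l+m=i}\sigma^m(\theta^{(l)}(a))\theta^{(m)}(b)$, and $\theta^{(i)}\theta^{(j)}=\binom{i+j}{i}_q\theta^{(i+j)}$ ($q$-binomial coefficient). Morphisms are $C$-algebra morphisms commuting with $\sigma$ and all $\theta^{(i)}$. A qsi algebra is simple if its only two-sided ideals stable under $\sigma^{\pm1}$ and all $\theta^{(i)}$ are $0$ and the whole algebra. $\mathcal{R}^\natural$ denotes the underlying abstract algebra. $M=Cm_1\oplus Cm_2$ is the $C[\sigma,\sigma^{-1},\theta^*]$-module with $\sigma(m_1)=qm_1$, $\sigma(m_2)=m_2$, $\theta^{(1)}(m_1)=m_2$, $\theta^{(1)}(m_2)=0$. $R=C\langle t,Q,Q^{-1}\rangle$ is the $C$-algebra generated by $t,Q,Q^{-1}$ with relations $QQ^{-1}=Q^{-1}Q=1$, $Qt=qtQ$, with the qsi structure $\sigma(Q)=qQ$, $\theta^{(1)}(Q)=0$, $\sigma(t)=qt$, $\theta^{(1)}(t)=1$, $\theta^{(m)}=\frac1{[m]_q!}(\theta^{(1)})^m$, where $[m]_q!=\prod_{i=1}^m(1+q+\dots+q^{i-1})$. *)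

theory Defs
  imports "HOL-Algebra.Module" "HOL-Algebra.QuotRing" "HOL-Algebra.Generated_Rings"
begin

definition q_int :: "('c, 'k) ring_scheme \<Rightarrow> 'c \<Rightarrow> nat \<Rightarrow> 'c" where
  "q_int C q n = (\<Oplus>\<^bsub>C\<^esub>j\<in>{..<n}. q [^]\<^bsub>C\<^esub> j)"

definition q_fact :: "('c, 'k) ring_scheme \<Rightarrow> 'c \<Rightarrow> nat \<Rightarrow> 'c" where
  "q_fact C q n = (\<Otimes>\<^bsub>C\<^esub>i\<in>{1..n}. q_int C q i)"

text \<open>
  The factorial formula is meaningful only when \<open>q\<close> is not a root of unity (so that all
  q-factorials are invertible); it is only used for such \<open>q\<close>.
\<close>

definition q_binomial :: "('c, 'k) ring_scheme \<Rightarrow> 'c \<Rightarrow> nat \<Rightarrow> nat \<Rightarrow> 'c" where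
  "q_binomial C q n k =
     q_fact C q n \<otimes>\<^bsub>C\<^esub> inv\<^bsub>C\<^esub> (q_fact C q k \<otimes>\<^bsub>C\<^esub> q_fact C q (n - k))"

text \<open>The library's \<^locale>\<open>algebra\<close> is restricted to commutative algebras.\<close>

locale assoc_algebra = module + ring M +
  assumes smult_mult_left:
      "\<lbrakk> c \<in> carrier R; x \<in> carrier M; y \<in> carrier M \<rbrakk> \<Longrightarrow>
        (c \<odot>\<^bsub>M\<^esub> x) \<otimes>\<^bsub>M\<^esub> y = c \<odot>\<^bsub>M\<^esub> (x \<otimes>\<^bsub>M\<^esub> y)"
    and smult_mult_right:
      "\<lbrakk> c \<in> carrier R; x \<in> carrier M; y \<in> carrier M \<rbrakk> \<Longrightarrow>
        x \<otimes>\<^bsub>M\<^esub> (c \<odot>\<^bsub>M\<^esub> y) = c \<odot>\<^bsub>M\<^esub> (x \<otimes>\<^bsub>M\<^esub> y)"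

definition generated_algebra ::
    "('c, 'k) ring_scheme \<Rightarrow> ('c, 'a, 'm) module_scheme \<Rightarrow> 'a set \<Rightarrow> 'a set" where
  "generated_algebra C A S =
     generate_ring A ((\<lambda>c. c \<odot>\<^bsub>A\<^esub> \<one>\<^bsub>A\<^esub>) ` carrier C \<union> S)"

record ('c, 'a) qsi = "('c, 'a) module" +
  qsigma :: "'a \<Rightarrow> 'a"
  qtheta :: "nat \<Rightarrow> 'a \<Rightarrow> 'a"

locale qsi_algebra = assoc_algebra C A
  for C :: "('c, 'k) ring_scheme" and q :: 'c and A :: "('c, 'a, 'm) qsi_scheme" +
  assumes sigma_auto: "qsigma A \<in> ring_iso A A"
    and sigma_smult:
      "\<lbrakk> c \<in> carrier C; x \<in> carrier A \<rbrakk> \<Longrightarrow>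
        qsigma A (c \<odot>\<^bsub>A\<^esub> x) = c \<odot>\<^bsub>A\<^esub> qsigma A x"
    and theta_closed: "x \<in> carrier A \<Longrightarrow> qtheta A i x \<in> carrier A"
    and theta_add:
      "\<lbrakk> x \<in> carrier A; y \<in> carrier A \<rbrakk> \<Longrightarrow>
        qtheta A i (x \<oplus>\<^bsub>A\<^esub> y) = qtheta A i x \<oplus>\<^bsub>A\<^esub> qtheta A i y"
    and theta_smult:
      "\<lbrakk> c \<in> carrier C; x \<in> carrier A \<rbrakk> \<Longrightarrow>
        qtheta A i (c \<odot>\<^bsub>A\<^esub> x) = c \<odot>\<^bsub>A\<^esub> qtheta A i x"
    and theta_0: "x \<in> carrier A \<Longrightarrow> qtheta A 0 x = x"
    and theta_sigma:
      "x \<in> carrier A \<Longrightarrow>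
        qtheta A i (qsigma A x) = (q [^]\<^bsub>C\<^esub> i) \<odot>\<^bsub>A\<^esub> qsigma A (qtheta A i x)"
    and theta_mult:
      "\<lbrakk> a \<in> carrier A; b \<in> carrier A \<rbrakk> \<Longrightarrow>
        qtheta A i (a \<otimes>\<^bsub>A\<^esub> b) =
          (\<Oplus>\<^bsub>A\<^esub>m\<in>{..i}. (qsigma A ^^ m) (qtheta A (i - m) a) \<otimes>\<^bsub>A\<^esub> qtheta A m b)"
    and theta_theta:
      "x \<in> carrier A \<Longrightarrow>
        qtheta A i (qtheta A j x) = q_binomial C q (i + j) i \<odot>\<^bsub>A\<^esub> qtheta A (i + j) x"

definition qsi_ideal :: "('c, 'a, 'm) qsi_scheme \<Rightarrow> 'a set \<Rightarrow> bool" where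
  "qsi_ideal A J \<longleftrightarrow>
     ideal J A \<and> qsigma A ` J \<subseteq> J \<and> inv_into (carrier A) (qsigma A) ` J \<subseteq> J \<and>
     (\<forall>i. qtheta A i ` J \<subseteq> J)"

definition qsi_simple :: "('c, 'a, 'm) qsi_scheme \<Rightarrow> bool" where
  "qsi_simple A \<longleftrightarrow> (\<forall>J. qsi_ideal A J \<longrightarrow> J = {\<zero>\<^bsub>A\<^esub>} \<or> J = carrier A)"

definition qsi_isomorphic ::
    "('c, 'k) ring_scheme \<Rightarrow> ('c, 'a, 'm) qsi_scheme \<Rightarrow> ('c, 'b, 'n) qsi_scheme \<Rightarrow> bool" where
  "qsi_isomorphic C A B \<longleftrightarrow>
     (\<exists>h \<in> ring_iso A B.
        (\<forall>c \<in> carrier C. \<forall>x \<in> carrier A. h (c \<odot>\<^bsub>A\<^esub> x) = c \<odot>\<^bsub>B\<^esub> h x) \<and>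
        (\<forall>x \<in> carrier A. h (qsigma A x) = qsigma B (h x)) \<and>
        (\<forall>i. \<forall>x \<in> carrier A. h (qtheta A i x) = qtheta B i (h x)))"

definition has_rational_point ::
    "('c, 'k) ring_scheme \<Rightarrow> ('c, 'a, 'm) module_scheme \<Rightarrow> bool" where
  "has_rational_point C A \<longleftrightarrow>
     (\<exists>h \<in> ring_hom A C.
        \<forall>c \<in> carrier C. \<forall>x \<in> carrier A. h (c \<odot>\<^bsub>A\<^esub> x) = c \<otimes>\<^bsub>C\<^esub> h x)"

text \<open>2 by 2 matrices are functions of two indices, of which only the values on \<open>{1, 2}\<close> matter.\<close>

definition mat2_inverse ::
    "('a, 'm) ring_scheme \<Rightarrow> (nat \<Rightarrow> nat \<Rightarrow> 'a) \<Rightarrow> (nat \<Rightarrow> nat \<Rightarrow> 'a) \<Rightarrow> bool" where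
  "mat2_inverse A Y Z \<longleftrightarrow>
     (\<forall>i \<in> {1, 2}. \<forall>j \<in> {1, 2}.
        (\<Oplus>\<^bsub>A\<^esub>k\<in>{1, 2}. Y i k \<otimes>\<^bsub>A\<^esub> Z k j) = (if i = j then \<one>\<^bsub>A\<^esub> else \<zero>\<^bsub>A\<^esub>) \<and>
        (\<Oplus>\<^bsub>A\<^esub>k\<in>{1, 2}. Z i k \<otimes>\<^bsub>A\<^esub> Y k j) = (if i = j then \<one>\<^bsub>A\<^esub> else \<zero>\<^bsub>A\<^esub>))"

text \<open>
  The action on \<open>M = C m\<^sub>1 \<oplus> C m\<^sub>2\<close>: entry \<open>i k\<close> is the coefficient of \<open>m\<^sub>k\<close> in
  \<open>\<sigma>(m\<^sub>i)\<close>, respectively in \<open>\<theta>(m\<^sub>i)\<close> with \<open>\<theta> = \<theta>\<^sup>(\<^sup>1\<^sup>)\<close>.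
\<close>

definition M_sigma :: "('c, 'k) ring_scheme \<Rightarrow> 'c \<Rightarrow> nat \<Rightarrow> nat \<Rightarrow> 'c" where
  "M_sigma C q i k = (if i = 1 \<and> k = 1 then q else if i = 2 \<and> k = 2 then \<one>\<^bsub>C\<^esub> else \<zero>\<^bsub>C\<^esub>)"

definition M_theta :: "('c, 'k) ring_scheme \<Rightarrow> nat \<Rightarrow> nat \<Rightarrow> 'c" where
  "M_theta C i k = (if i = 1 \<and> k = 2 then \<one>\<^bsub>C\<^esub> else \<zero>\<^bsub>C\<^esub>)"

definition fundamental_system_M ::
    "('c, 'k) ring_scheme \<Rightarrow> 'c \<Rightarrow> ('c, 'a, 'm) qsi_scheme \<Rightarrow>
      (nat \<Rightarrow> nat \<Rightarrow> 'a) \<Rightarrow> (nat \<Rightarrow> nat \<Rightarrow> 'a) \<Rightarrow> bool" where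
  "fundamental_system_M C q A Y Y_inv \<longleftrightarrow>
     (\<forall>i \<in> {1, 2}. \<forall>j \<in> {1, 2}. Y i j \<in> carrier A \<and> Y_inv i j \<in> carrier A) \<and>
     mat2_inverse A Y Y_inv \<and>
     (\<forall>i \<in> {1, 2}. \<forall>j \<in> {1, 2}.
        qsigma A (Y i j) = (\<Oplus>\<^bsub>A\<^esub>k\<in>{1, 2}. M_sigma C q i k \<odot>\<^bsub>A\<^esub> Y k j) \<and>
        qtheta A 1 (Y i j) = (\<Oplus>\<^bsub>A\<^esub>k\<in>{1, 2}. M_theta C i k \<odot>\<^bsub>A\<^esub> Y k j))"

definition mat2_entries :: "(nat \<Rightarrow> nat \<Rightarrow> 'a) \<Rightarrow> 'a set" where
  "mat2_entries Y = {Y i j | i j. i \<in> {1, 2} \<and> j \<in> {1, 2}}"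

text \<open>
  The free associative algebra on a type of generators: finitely supported coefficient functions
  on words, multiplied by convolution over all ways of cutting a word in two.
\<close>

definition free_algebra :: "('c, 'k) ring_scheme \<Rightarrow> ('c, 'g list \<Rightarrow> 'c) module" where
  "free_algebra C =
     \<lparr> carrier = {f. (\<forall>w. f w \<in> carrier C) \<and> finite {w. f w \<noteq> \<zero>\<^bsub>C\<^esub>}},
       mult = (\<lambda>f g w. \<Oplus>\<^bsub>C\<^esub>i\<in>{..length w}. f (take i w) \<otimes>\<^bsub>C\<^esub> g (drop i w)),
       one = (\<lambda>w. if w = [] then \<one>\<^bsub>C\<^esub> else \<zero>\<^bsub>C\<^esub>),
       zero = (\<lambda>w. \<zero>\<^bsub>C\<^esub>),
       add = (\<lambda>f g w. f w \<oplus>\<^bsub>C\<^esub> g w),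
       smult = (\<lambda>c f w. c \<otimes>\<^bsub>C\<^esub> f w) \<rparr>"

definition free_word :: "('c, 'k) ring_scheme \<Rightarrow> 'g list \<Rightarrow> 'g list \<Rightarrow> 'c" where
  "free_word C w = (\<lambda>v. if v = w then \<one>\<^bsub>C\<^esub> else \<zero>\<^bsub>C\<^esub>)"

definition free_linear ::
    "('c, 'k) ring_scheme \<Rightarrow> ('g list \<Rightarrow> 'g list \<Rightarrow> 'c) \<Rightarrow> ('g list \<Rightarrow> 'c) \<Rightarrow> 'g list \<Rightarrow> 'c" where
  "free_linear C h f =
     (\<Oplus>\<^bsub>free_algebra C\<^esub>w\<in>{w. f w \<noteq> \<zero>\<^bsub>C\<^esub>}. f w \<odot>\<^bsub>free_algebra C\<^esub> h w)"

datatype pv_gen = Gen_t | Gen_Q | Gen_Qinv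

abbreviation pv_free :: "('c, 'k) ring_scheme \<Rightarrow> ('c, pv_gen list \<Rightarrow> 'c) module" where
  "pv_free C \<equiv> free_algebra C"

definition pv_relations :: "('c, 'k) ring_scheme \<Rightarrow> 'c \<Rightarrow> (pv_gen list \<Rightarrow> 'c) set" where
  "pv_relations C q =
     {free_word C [Gen_Q, Gen_Qinv] \<ominus>\<^bsub>pv_free C\<^esub> \<one>\<^bsub>pv_free C\<^esub>,
      free_word C [Gen_Qinv, Gen_Q] \<ominus>\<^bsub>pv_free C\<^esub> \<one>\<^bsub>pv_free C\<^esub>,
      free_word C [Gen_Q, Gen_t] \<ominus>\<^bsub>pv_free C\<^esub> q \<odot>\<^bsub>pv_free C\<^esub> free_word C [Gen_t, Gen_Q]}"

definition pv_ideal :: "('c, 'k) ring_scheme \<Rightarrow> 'c \<Rightarrow> (pv_gen list \<Rightarrow> 'c) set" where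
  "pv_ideal C q = Idl\<^bsub>pv_free C\<^esub> (pv_relations C q)"

text \<open>
  \<open>\<sigma>\<close> and \<open>\<theta> = \<theta>\<^sup>(\<^sup>1\<^sup>)\<close> are first defined on the free algebra, as the algebra endomorphism and
  the C-linear map with \<open>\<theta>(ab) = \<theta>(a) b + \<sigma>(a) \<theta>(b)\<close> having the prescribed values on generators.
  The values on \<open>Q\<^sup>-\<^sup>1\<close> are forced by \<open>Q Q\<^sup>-\<^sup>1 = 1\<close>.
\<close>

fun pv_sigma_gen :: "('c, 'k) ring_scheme \<Rightarrow> 'c \<Rightarrow> pv_gen \<Rightarrow> pv_gen list \<Rightarrow> 'c" where
  "pv_sigma_gen C q Gen_t = q \<odot>\<^bsub>pv_free C\<^esub> free_word C [Gen_t]"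
| "pv_sigma_gen C q Gen_Q = q \<odot>\<^bsub>pv_free C\<^esub> free_word C [Gen_Q]"
| "pv_sigma_gen C q Gen_Qinv = (inv\<^bsub>C\<^esub> q) \<odot>\<^bsub>pv_free C\<^esub> free_word C [Gen_Qinv]"

fun pv_theta_gen :: "('c, 'k) ring_scheme \<Rightarrow> pv_gen \<Rightarrow> pv_gen list \<Rightarrow> 'c" where
  "pv_theta_gen C Gen_t = \<one>\<^bsub>pv_free C\<^esub>"
| "pv_theta_gen C Gen_Q = \<zero>\<^bsub>pv_free C\<^esub>"
| "pv_theta_gen C Gen_Qinv = \<zero>\<^bsub>pv_free C\<^esub>"

fun pv_sigma_word :: "('c, 'k) ring_scheme \<Rightarrow> 'c \<Rightarrow> pv_gen list \<Rightarrow> pv_gen list \<Rightarrow> 'c" where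
  "pv_sigma_word C q [] = \<one>\<^bsub>pv_free C\<^esub>"
| "pv_sigma_word C q (x # w) = pv_sigma_gen C q x \<otimes>\<^bsub>pv_free C\<^esub> pv_sigma_word C q w"

fun pv_theta_word :: "('c, 'k) ring_scheme \<Rightarrow> 'c \<Rightarrow> pv_gen list \<Rightarrow> pv_gen list \<Rightarrow> 'c" where
  "pv_theta_word C q [] = \<zero>\<^bsub>pv_free C\<^esub>"
| "pv_theta_word C q (x # w) =
     (pv_theta_gen C x \<otimes>\<^bsub>pv_free C\<^esub> free_word C w) \<oplus>\<^bsub>pv_free C\<^esub>
     (pv_sigma_gen C q x \<otimes>\<^bsub>pv_free C\<^esub> pv_theta_word C q w)"

text \<open>
  The map induced by \<open>h\<close> on the cosets of an ideal \<open>I\<close>; the union is over equal cosets when \<open>h\<close>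
  is additive and preserves \<open>I\<close>.
\<close>

definition coset_map :: "('a, 'm) ring_scheme \<Rightarrow> 'a set \<Rightarrow> ('a \<Rightarrow> 'a) \<Rightarrow> 'a set \<Rightarrow> 'a set" where
  "coset_map F I h X = (\<Union>x\<in>X. I +>\<^bsub>F\<^esub> h x)"

definition pv_smult ::
    "('c, 'k) ring_scheme \<Rightarrow> 'c \<Rightarrow> 'c \<Rightarrow> (pv_gen list \<Rightarrow> 'c) set \<Rightarrow> (pv_gen list \<Rightarrow> 'c) set" where
  "pv_smult C q c = coset_map (pv_free C) (pv_ideal C q) (\<lambda>x. c \<odot>\<^bsub>pv_free C\<^esub> x)"

definition pv_sigma ::
    "('c, 'k) ring_scheme \<Rightarrow> 'c \<Rightarrow> (pv_gen list \<Rightarrow> 'c) set \<Rightarrow> (pv_gen list \<Rightarrow> 'c) set" where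
  "pv_sigma C q = coset_map (pv_free C) (pv_ideal C q) (free_linear C (pv_sigma_word C q))"

definition pv_theta1 ::
    "('c, 'k) ring_scheme \<Rightarrow> 'c \<Rightarrow> (pv_gen list \<Rightarrow> 'c) set \<Rightarrow> (pv_gen list \<Rightarrow> 'c) set" where
  "pv_theta1 C q = coset_map (pv_free C) (pv_ideal C q) (free_linear C (pv_theta_word C q))"

definition pv_ring ::
    "('c, 'k) ring_scheme \<Rightarrow> 'c \<Rightarrow> ('c, (pv_gen list \<Rightarrow> 'c) set) qsi" where
  "pv_ring C q =
     ring.extend (pv_free C Quot pv_ideal C q)
       \<lparr> smult = pv_smult C q,
         qsigma = pv_sigma C q,
         qtheta = (\<lambda>m X. pv_smult C q (inv\<^bsub>C\<^esub> (q_fact C q m)) ((pv_theta1 C q ^^ m) X)) \<rparr>"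

end

theory Submission
  imports Defs
begin

text \<open>
  Let \<open>pt : A \<rightarrow> C\<close> be the rational point, \<open>\<theta> = \<theta>\<^sup>(\<^sup>1\<^sup>)\<close>, and call \<open>a\<close> semiconstant if
  \<open>\<sigma>(a) = c a\<close> for a non-zero scalar \<open>c\<close> and \<open>\<theta>(a) = 0\<close>. As \<open>q\<close> is not a root of unity, the
  \<open>q\<close>-factorials are invertible, so \<open>\<theta>\<^sup>(\<^sup>m\<^sup>) = \<theta>\<^sup>m / [m]\<^sub>q!\<close> and all higher \<open>\<theta>\<^sup>(\<^sup>m\<^sup>)\<close> kill \<open>a\<close> too.
  Hence the two-sided ideal generated by \<open>a\<close> is a qsi ideal. If moreover \<open>pt(a) = 0\<close>, this ideal
  lies in the kernel of \<open>pt\<close>, does not contain \<open>1\<close>, and is zero by simplicity. So two elements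
  of the same \<open>\<sigma>\<close>-weight, with the same \<open>\<theta>\<close> and the same value at \<open>pt\<close>, are equal
  (\<open>semiconstant_eqI\<close>).

  The second row of \<open>Y\<close> consists of semiconstants of weight \<open>1\<close>, as do the scalars, so it
  consists of scalars. Multiplying \<open>Y\<close> on the right by the scalar matrix \<open>pt(Y\<^sup>-\<^sup>1)\<close> then gives a matrix with
  rows \<open>(Q, t)\<close> and \<open>(0, 1)\<close>, where \<open>\<sigma>\<close> scales \<open>Q\<close> and \<open>t\<close> by \<open>q\<close>, \<open>\<theta>(Q) = 0\<close>, \<open>\<theta>(t) = 1\<close>,
  \<open>pt(Q) = 1\<close> and \<open>pt(t) = 0\<close>. Invertibility of \<open>Y\<close> makes \<open>Q\<close> invertible, and \<open>A\<close> is generated by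
  \<open>t\<close>, \<open>Q\<close>, \<open>Q\<^sup>-\<^sup>1\<close>. The products \<open>Q t\<close> and \<open>q t Q\<close> have the same weight, the same \<open>\<theta>\<close>
  and the same value at \<open>pt\<close>, so they agree (\<open>q_skew_triple_exists\<close>).

  Thus evaluation at \<open>t\<close>, \<open>Q\<close>, \<open>Q\<^sup>-\<^sup>1\<close> maps the free algebra onto \<open>A\<close>, and its kernel contains the
  defining ideal of the Picard-Vessiot ring. The two ideals are equal (\<open>kernel_eq_ideal\<close>): modulo
  the relations every element becomes, after left multiplication by a power of \<open>Q\<close>, a
  combination of monomials \<open>t\<^sup>i Q\<^sup>n\<close> with \<open>i, n \<ge> 0\<close> (\<open>normal_form\<close>), and these monomials are linearly
  independent in \<open>A\<close>, because \<open>\<theta>\<close> lowers the degree in \<open>t\<close> and the powers of \<open>Q\<close> have different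
  \<open>\<sigma>\<close>-weights (\<open>normal_words_independent\<close>). The isomorphism sends \<open>a\<close> to the fibre of the evaluation
  over \<open>a\<close>, which is a coset of the ideal. Since evaluation intertwines the operators on the free
  algebra with those of \<open>A\<close>, the operators that they induce on cosets correspond to those of \<open>A\<close>
  (\<open>qsi_isomorphic_pv_ring\<close>).
\<close>

section \<open>The free associative algebra\<close>

definition linear_map ::
    "('c, 'k) ring_scheme \<Rightarrow> ('c, 'a, 'm) module_scheme \<Rightarrow> ('c, 'b, 'n) module_scheme \<Rightarrow>
      ('a \<Rightarrow> 'b) \<Rightarrow> bool" where
  "linear_map C M N T \<longleftrightarrow>
     (\<forall>x \<in> carrier M. T x \<in> carrier N) \<and>
     (\<forall>x \<in> carrier M. \<forall>y \<in> carrier M. T (x \<oplus>\<^bsub>M\<^esub> y) = T x \<oplus>\<^bsub>N\<^esub> T y) \<and>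
     (\<forall>c \<in> carrier C. \<forall>x \<in> carrier M. T (c \<odot>\<^bsub>M\<^esub> x) = c \<odot>\<^bsub>N\<^esub> T x)"

lemma linear_map_comp:
  "\<lbrakk>linear_map C M N T; linear_map C N L U\<rbrakk> \<Longrightarrow> linear_map C M L (\<lambda>x. U (T x))"
  by (simp add: linear_map_def)

definition linear_extension ::
    "('c, 'k) ring_scheme \<Rightarrow> ('c, 'a, 'm) module_scheme \<Rightarrow> ('w \<Rightarrow> 'a) \<Rightarrow> ('w \<Rightarrow> 'c) \<Rightarrow> 'a" where
  "linear_extension C N h f =
     (\<Oplus>\<^bsub>N\<^esub>w\<in>{w. f w \<noteq> \<zero>\<^bsub>C\<^esub>}. f w \<odot>\<^bsub>N\<^esub> h w)"

context cring
begin

abbreviation conv :: "('g list \<Rightarrow> 'a) \<Rightarrow> ('g list \<Rightarrow> 'a) \<Rightarrow> 'g list \<Rightarrow> 'a" where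
  "conv f g \<equiv> f \<otimes>\<^bsub>free_algebra R\<^esub> g"

lemma free_add_apply: "(f \<oplus>\<^bsub>free_algebra R\<^esub> g) w = f w \<oplus> g w"
  and free_zero_apply: "\<zero>\<^bsub>free_algebra R\<^esub> w = \<zero>"
  and free_one_apply: "\<one>\<^bsub>free_algebra R\<^esub> w = (if w = [] then \<one> else \<zero>)"
  and free_smult_apply: "(c \<odot>\<^bsub>free_algebra R\<^esub> f) w = c \<otimes> f w"
  by (simp_all add: free_algebra_def)

lemma conv_def: "conv f g w = (\<Oplus>i\<in>{..length w}. f (take i w) \<otimes> g (drop i w))"
  by (simp add: free_algebra_def)

lemma conv_Nil:
  assumes "\<And>w. f w \<in> carrier R" "\<And>w. g w \<in> carrier R"
  shows "conv f g [] = f [] \<otimes> g []"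
  using assms by (simp add: conv_def)

text \<open>
  A cut of \<open>x # w\<close> is either before \<open>x\<close> or comes from a cut of \<open>w\<close>. So convolution is determined
  by recursion on words through the left derivative \<open>f \<mapsto> (\<lambda>v. f (x # v))\<close>. All ring laws below
  follow from this recursion by induction on words, which avoids rearranging double sums.
\<close>

lemma conv_Cons:
  assumes "\<And>w. f w \<in> carrier R" "\<And>w. g w \<in> carrier R"
  shows "conv f g (x # w) = f [] \<otimes> g (x # w) \<oplus> conv (\<lambda>v. f (x # v)) g w"
proof -
  have "conv f g (x # w) = (\<Oplus>i\<in>{..length w}. f (x # take i w) \<otimes> g (drop i w)) \<oplus> f [] \<otimes> g (x # w)"
    using assms by (simp add: conv_def finsum_Suc2 del: finsum_Suc)
  then show ?thesis
    using assms by (simp add: conv_def a_comm)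
qed

lemma conv_closed:
  assumes "\<And>w. f w \<in> carrier R" "\<And>w. g w \<in> carrier R"
  shows "conv f g w \<in> carrier R"
  using assms by (auto simp: conv_def)

lemma conv_add_left:
  assumes "\<And>w. f w \<in> carrier R" "\<And>w. f' w \<in> carrier R" "\<And>w. g w \<in> carrier R"
  shows "conv (\<lambda>v. f v \<oplus> f' v) g w = conv f g w \<oplus> conv f' g w"
  using assms
  by (induction w arbitrary: f f')
     (simp_all add: conv_Nil conv_Cons conv_closed l_distr a_ac)

lemma conv_add_right:
  assumes "\<And>w. f w \<in> carrier R" "\<And>w. g w \<in> carrier R" "\<And>w. g' w \<in> carrier R"
  shows "conv f (\<lambda>v. g v \<oplus> g' v) w = conv f g w \<oplus> conv f g' w"
  using assms
  by (induction w arbitrary: f)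
     (simp_all add: conv_Nil conv_Cons conv_closed r_distr a_ac)

lemma conv_smult_left:
  assumes "c \<in> carrier R" "\<And>w. f w \<in> carrier R" "\<And>w. g w \<in> carrier R"
  shows "conv (\<lambda>v. c \<otimes> f v) g w = c \<otimes> conv f g w"
  using assms
  by (induction w arbitrary: f)
     (simp_all add: conv_Nil conv_Cons conv_closed r_distr m_assoc)

lemma conv_smult_right:
  assumes "c \<in> carrier R" "\<And>w. f w \<in> carrier R" "\<And>w. g w \<in> carrier R"
  shows "conv f (\<lambda>v. c \<otimes> g v) w = c \<otimes> conv f g w"
  using assms
  by (induction w arbitrary: f)
     (simp_all add: conv_Nil conv_Cons conv_closed r_distr m_lcomm)

text \<open>
  The induction works because the left derivative of a product is again of the form scalar
  multiple plus product: the derivative of \<open>f g\<close> is \<open>f [] \<cdot> D g + (D f) g\<close>, and the induction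
  hypothesis applies to \<open>D f\<close>.
\<close>

lemma conv_assoc:
  assumes "\<And>w. f w \<in> carrier R" "\<And>w. g w \<in> carrier R" "\<And>w. h w \<in> carrier R"
  shows "conv (conv f g) h w = conv f (conv g h) w"
  using assms(1)
proof (induction w arbitrary: f)
  case Nil
  then show ?case
    using assms by (simp add: conv_Nil conv_closed m_assoc)
next
  case (Cons x w)
  let ?D = "\<lambda>k v. k (x # v)"
  have D: "?D f v \<in> carrier R" "?D g v \<in> carrier R" for v
    using Cons.prems assms by auto
  have "conv (conv f g) h (x # w) = f [] \<otimes> g [] \<otimes> h (x # w) \<oplus> conv (?D (conv f g)) h w"
    using Cons.prems assms by (simp add: conv_Nil conv_Cons conv_closed)
  also have "?D (conv f g) = (\<lambda>v. f [] \<otimes> ?D g v \<oplus> conv (?D f) g v)"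
    using Cons.prems assms by (simp add: conv_Cons)
  also have "conv \<dots> h w = f [] \<otimes> conv (?D g) h w \<oplus> conv (conv (?D f) g) h w"
    using Cons.prems assms D by (simp add: conv_add_left conv_smult_left conv_closed)
  also have "conv (conv (?D f) g) h w = conv (?D f) (conv g h) w"
    using Cons.IH[of "?D f"] D by simp
  finally have "conv (conv f g) h (x # w) =
      f [] \<otimes> g [] \<otimes> h (x # w) \<oplus> (f [] \<otimes> conv (?D g) h w \<oplus> conv (?D f) (conv g h) w)" .
  moreover have "conv f (conv g h) (x # w) =
      f [] \<otimes> (g [] \<otimes> h (x # w) \<oplus> conv (?D g) h w) \<oplus> conv (?D f) (conv g h) w"
    using Cons.prems assms by (simp add: conv_Cons conv_closed)
  ultimately show ?case
    using Cons.prems assms D by (simp add: conv_closed r_distr m_assoc a_assoc)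
qed

lemma conv_one_left:
  assumes "\<And>w. f w \<in> carrier R"
  shows "conv \<one>\<^bsub>free_algebra R\<^esub> f w = f w"
proof (cases w)
  case Nil
  then show ?thesis
    using assms by (simp add: conv_Nil free_one_apply)
next
  case (Cons x v)
  have "conv (\<lambda>u. \<zero>) f v = \<zero>"
    using assms by (simp add: conv_def)
  then show ?thesis
    using assms Cons by (simp add: conv_Cons free_one_apply)
qed

lemma conv_one_right:
  assumes "\<And>w. f w \<in> carrier R"
  shows "conv f \<one>\<^bsub>free_algebra R\<^esub> w = f w"
  using assms
proof (induction w arbitrary: f)
  case Nil
  then show ?case
    by (simp add: conv_Nil free_one_apply)
next
  case (Cons x w)
  show ?case
    using Cons by (simp add: conv_Cons free_one_apply)
qed

lemma free_algebra_memI: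
  "\<lbrakk>\<And>w. f w \<in> carrier R; finite {w. f w \<noteq> \<zero>}\<rbrakk> \<Longrightarrow> f \<in> carrier (free_algebra R)"
  by (simp add: free_algebra_def)

lemma free_algebra_memD:
  assumes "f \<in> carrier (free_algebra R)"
  shows "f w \<in> carrier R" "finite {w. f w \<noteq> \<zero>}"
  using assms by (simp_all add: free_algebra_def)

lemma free_algebra_add_closed:
  assumes "f \<in> carrier (free_algebra R)" "g \<in> carrier (free_algebra R)"
  shows "f \<oplus>\<^bsub>free_algebra R\<^esub> g \<in> carrier (free_algebra R)"
proof (rule free_algebra_memI)
  have "{w. (f \<oplus>\<^bsub>free_algebra R\<^esub> g) w \<noteq> \<zero>} \<subseteq> {w. f w \<noteq> \<zero>} \<union> {w. g w \<noteq> \<zero>}"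
    by (auto simp: free_add_apply)
  then show "finite {w. (f \<oplus>\<^bsub>free_algebra R\<^esub> g) w \<noteq> \<zero>}"
    using assms[THEN free_algebra_memD(2)] by (meson finite_UnI finite_subset)
qed (use assms in \<open>auto simp: free_add_apply dest: free_algebra_memD\<close>)

lemma free_algebra_smult_closed:
  assumes "c \<in> carrier R" "f \<in> carrier (free_algebra R)"
  shows "c \<odot>\<^bsub>free_algebra R\<^esub> f \<in> carrier (free_algebra R)"
proof (rule free_algebra_memI)
  have "{w. (c \<odot>\<^bsub>free_algebra R\<^esub> f) w \<noteq> \<zero>} \<subseteq> {w. f w \<noteq> \<zero>}"
    using assms by (auto simp: free_smult_apply)
  then show "finite {w. (c \<odot>\<^bsub>free_algebra R\<^esub> f) w \<noteq> \<zero>}"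
    using free_algebra_memD(2)[OF assms(2)] by (meson finite_subset)
qed (use assms in \<open>auto simp: free_smult_apply dest: free_algebra_memD\<close>)

lemma free_algebra_mult_closed:
  assumes "f \<in> carrier (free_algebra R)" "g \<in> carrier (free_algebra R)"
  shows "conv f g \<in> carrier (free_algebra R)"
proof (rule free_algebra_memI)
  have mem: "\<And>w. f w \<in> carrier R" "\<And>w. g w \<in> carrier R"
    using assms by (auto dest: free_algebra_memD)
  have "w \<in> (\<lambda>(u, v). u @ v) ` ({u. f u \<noteq> \<zero>} \<times> {v. g v \<noteq> \<zero>})" if "conv f g w \<noteq> \<zero>" for w
  proof -
    obtain i where "f (take i w) \<otimes> g (drop i w) \<noteq> \<zero>"
      using \<open>conv f g w \<noteq> \<zero>\<close> add.finprod_one_eqI[of "{..length w}" "\<lambda>i. f (take i w) \<otimes> g (drop i w)"]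
      unfolding conv_def by blast
    then have "f (take i w) \<noteq> \<zero>" "g (drop i w) \<noteq> \<zero>"
      using mem by auto
    then show ?thesis
      by (intro image_eqI[where x = "(take i w, drop i w)"]) simp_all
  qed
  then have "{w. conv f g w \<noteq> \<zero>} \<subseteq> (\<lambda>(u, v). u @ v) ` ({u. f u \<noteq> \<zero>} \<times> {v. g v \<noteq> \<zero>})"
    by blast
  then show "finite {w. conv f g w \<noteq> \<zero>}"
    using assms[THEN free_algebra_memD(2)]
    by (meson finite_SigmaI finite_imageI finite_subset)
  show "\<And>w. conv f g w \<in> carrier R"
    using mem by (simp add: conv_closed)
qed

lemma free_zero_closed: "\<zero>\<^bsub>free_algebra R\<^esub> \<in> carrier (free_algebra R)"
  by (rule free_algebra_memI) (simp_all add: free_zero_apply)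

lemma free_word_closed: "free_word R w \<in> carrier (free_algebra R)"
  by (rule free_algebra_memI) (simp_all add: free_word_def)

lemma free_one_word: "\<one>\<^bsub>free_algebra R\<^esub> = free_word R []"
  by (simp add: free_word_def free_algebra_def)

lemma free_algebra_assoc_algebra:
  "assoc_algebra R (free_algebra R :: ('a, 'g list \<Rightarrow> 'a) module)" (is "assoc_algebra R ?F")
proof -
  have ag: "abelian_group ?F"
  proof (rule abelian_groupI)
    fix f :: "'g list \<Rightarrow> 'a" assume f: "f \<in> carrier ?F"
    have "(\<ominus> \<one>) \<odot>\<^bsub>?F\<^esub> f \<oplus>\<^bsub>?F\<^esub> f = \<zero>\<^bsub>?F\<^esub>"
      by (rule ext)
        (use f in \<open>simp add: free_add_apply free_smult_apply free_zero_apply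
            free_algebra_memD l_minus l_neg\<close>)
    then show "\<exists>g \<in> carrier ?F. g \<oplus>\<^bsub>?F\<^esub> f = \<zero>\<^bsub>?F\<^esub>"
      using f by (meson a_inv_closed free_algebra_smult_closed one_closed)
  next
    show "\<zero>\<^bsub>?F\<^esub> \<in> carrier ?F"
      by (rule free_zero_closed)
  qed (auto intro!: free_algebra_add_closed
      simp: fun_eq_iff free_add_apply free_zero_apply free_algebra_memD a_ac)
  have mon: "Group.monoid ?F"
  proof (rule monoidI)
    show "\<one>\<^bsub>?F\<^esub> \<in> carrier ?F"
      by (simp add: free_one_word free_word_closed)
  qed (simp_all add: fun_eq_iff free_algebra_mult_closed conv_assoc conv_one_left conv_one_right
      free_algebra_memD)
  have ring: "ring ?F"
  proof (rule ringI[OF ag mon])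
    fix f g h :: "'g list \<Rightarrow> 'a"
    assume mem: "f \<in> carrier ?F" "g \<in> carrier ?F" "h \<in> carrier ?F"
    have add: "k \<oplus>\<^bsub>?F\<^esub> l = (\<lambda>w. k w \<oplus> l w)" for k l :: "'g list \<Rightarrow> 'a"
      by (rule ext) (rule free_add_apply)
    show "conv (f \<oplus>\<^bsub>?F\<^esub> g) h = conv f h \<oplus>\<^bsub>?F\<^esub> conv g h"
      using mem by (simp add: fun_eq_iff add conv_add_left free_algebra_memD)
    show "conv h (f \<oplus>\<^bsub>?F\<^esub> g) = conv h f \<oplus>\<^bsub>?F\<^esub> conv h g"
      using mem by (simp add: fun_eq_iff add conv_add_right free_algebra_memD)
  qed
  have mod: "module R ?F"
    by (rule moduleI[OF is_cring ag])
      (simp_all add: fun_eq_iff free_algebra_smult_closed free_smult_apply free_add_apply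
        free_algebra_memD l_distr r_distr m_assoc)
  have "assoc_algebra_axioms R ?F"
  proof
    fix c and f g :: "'g list \<Rightarrow> 'a"
    assume mem: "c \<in> carrier R" "f \<in> carrier ?F" "g \<in> carrier ?F"
    have smult: "c \<odot>\<^bsub>?F\<^esub> k = (\<lambda>w. c \<otimes> k w)" for k :: "'g list \<Rightarrow> 'a"
      by (rule ext) (rule free_smult_apply)
    show "conv (c \<odot>\<^bsub>?F\<^esub> f) g = c \<odot>\<^bsub>?F\<^esub> conv f g" "conv f (c \<odot>\<^bsub>?F\<^esub> g) = c \<odot>\<^bsub>?F\<^esub> conv f g"
      using mem by (simp_all add: fun_eq_iff smult conv_smult_left conv_smult_right free_algebra_memD)
  qed
  then show ?thesis
    using mod ring by (intro assoc_algebra.intro)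
qed

lemma free_word_mult:
  fixes u v :: "'g list"
  shows "conv (free_word R u) (free_word R v) = free_word R (u @ v)"
proof (induction u)
  case Nil
  show ?case
    by (rule ext, subst free_one_word[symmetric], subst conv_one_left) (simp_all add: free_word_def)
next
  case (Cons x u)
  have mem: "free_word R u' w \<in> carrier R" for u' w :: "'g list"
    by (simp add: free_word_def)
  show ?case
  proof
    fix w
    show "conv (free_word R (x # u)) (free_word R v) w = free_word R ((x # u) @ v) w"
    proof (cases w)
      case Nil
      then show ?thesis
        by (simp add: conv_Nil mem) (simp add: free_word_def)
    next
      case w: (Cons y w')
      have D: "(\<lambda>z. free_word R (x # u) (y # z)) = (if y = x then free_word R u else (\<lambda>z. \<zero>))"
        by (auto simp: free_word_def)
      have "conv (\<lambda>z. \<zero>) (free_word R v) w' = \<zero>"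
        by (simp add: conv_def mem)
      then show ?thesis
        using w Cons.IH
        by (simp add: conv_Cons mem D conv_closed) (simp add: free_word_def)
    qed
  qed
qed

text \<open>
  The set \<open>S\<close> restricts the support, so that the same induction serves the whole free algebra and
  the span of a set of words.
\<close>

lemma free_algebra_induct [consumes 2, case_names zero add]:
  assumes "f \<in> carrier (free_algebra R)" and "{w. f w \<noteq> \<zero>} \<subseteq> S"
    and "P \<zero>\<^bsub>free_algebra R\<^esub>"
    and "\<And>f c w. \<lbrakk>f \<in> carrier (free_algebra R); c \<in> carrier R; w \<in> S; P f\<rbrakk> \<Longrightarrow>
           P (f \<oplus>\<^bsub>free_algebra R\<^esub> c \<odot>\<^bsub>free_algebra R\<^esub> free_word R w)"
  shows "P f"
proof -
  have "finite B \<Longrightarrow> f \<in> carrier (free_algebra R) \<Longrightarrow> {w. f w \<noteq> \<zero>} = B \<Longrightarrow> B \<subseteq> S \<Longrightarrow> P f" for B f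
  proof (induction B arbitrary: f rule: finite_induct)
    case empty
    then have "f = \<zero>\<^bsub>free_algebra R\<^esub>"
      by (auto simp: free_zero_apply)
    then show ?case
      using assms(3) by simp
  next
    case (insert u B)
    define g where "g = f(u := \<zero>)"
    have supp: "{w. g w \<noteq> \<zero>} = B"
      using insert.hyps(2) insert.prems(2) by (auto simp: g_def)
    have mem: "f w \<in> carrier R" for w
      using insert.prems(1) by (rule free_algebra_memD)
    have g: "g \<in> carrier (free_algebra R)"
      using supp insert.hyps(1) mem by (auto intro!: free_algebra_memI simp: g_def)
    have "f = g \<oplus>\<^bsub>free_algebra R\<^esub> f u \<odot>\<^bsub>free_algebra R\<^esub> free_word R u"
      using mem by (auto simp: g_def free_add_apply free_smult_apply free_word_def)
    moreover have "P (g \<oplus>\<^bsub>free_algebra R\<^esub> f u \<odot>\<^bsub>free_algebra R\<^esub> free_word R u)"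
      using insert.prems g mem supp insert.IH by (intro assms(4)) auto
    ultimately show ?case
      by simp
  qed
  then show ?thesis
    using assms(1,2) free_algebra_memD(2) by blast
qed

text \<open>
  Such maps describe \<open>\<sigma>\<close> and \<open>\<theta>\<close> on combinations of the monomials \<open>t\<^sup>i Q\<^sup>n\<close>: each monomial goes to
  a scalar multiple of one monomial.
\<close>

lemma weighted_shift_linear:
  fixes p :: "'g list \<Rightarrow> 'g list"
  assumes a: "\<And>w. a w \<in> carrier R" and p: "inj p"
  shows "linear_map R (free_algebra R) (free_algebra R) (\<lambda>f w. a w \<otimes> f (p w))"
proof -
  have "(\<lambda>w. a w \<otimes> f (p w)) \<in> carrier (free_algebra R)" if f: "f \<in> carrier (free_algebra R)" for f
  proof (rule free_algebra_memI)
    have "{w. a w \<otimes> f (p w) \<noteq> \<zero>} \<subseteq> p -` {w. f w \<noteq> \<zero>}"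
      using a by auto
    then show "finite {w. a w \<otimes> f (p w) \<noteq> \<zero>}"
      using finite_vimageI[OF free_algebra_memD(2)[OF f] p] by (rule finite_subset)
  qed (use a f in \<open>simp add: free_algebra_memD\<close>)
  then show ?thesis
    using a
    by (simp add: linear_map_def fun_eq_iff free_add_apply free_smult_apply free_algebra_memD
        r_distr m_lcomm)
qed

end

context module
begin

lemma linear_map_zero:
  assumes "linear_map R (free_algebra R) M T"
  shows "T \<zero>\<^bsub>free_algebra R\<^esub> = \<zero>\<^bsub>M\<^esub>"
proof -
  have z: "\<zero>\<^bsub>free_algebra R\<^esub> = \<zero> \<odot>\<^bsub>free_algebra R\<^esub> \<zero>\<^bsub>free_algebra R\<^esub>"
    by (rule ext) (simp add: R.free_smult_apply R.free_zero_apply)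
  show ?thesis
    using assms unfolding linear_map_def by (metis R.free_zero_closed R.zero_closed smult_l_null z)
qed

lemma linear_map_eqI:
  assumes "linear_map R (free_algebra R) M T" "linear_map R (free_algebra R) M U"
    and f: "f \<in> carrier (free_algebra R)" "{w. f w \<noteq> \<zero>} \<subseteq> S"
    and eq: "\<And>w. w \<in> S \<Longrightarrow> T (free_word R w) = U (free_word R w)"
  shows "T f = U f"
  using f
proof (induction f rule: R.free_algebra_induct)
  case zero
  then show ?case
    using assms by (simp add: linear_map_zero)
next
  case (add f c w)
  then show ?case
    using assms(1,2) eq R.free_algebra_smult_closed[OF \<open>c \<in> carrier R\<close> R.free_word_closed[of w]]
    by (simp add: linear_map_def R.free_word_closed)
qed

text \<open>
  The sum over the support is awkward because the support changes under addition; over a common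
  finite superset linearity is termwise.
\<close>

lemma linear_extension_superset:
  assumes "\<And>w. h w \<in> carrier M" "\<And>w. f w \<in> carrier R"
    and "finite B" "{w. f w \<noteq> \<zero>} \<subseteq> B"
  shows "linear_extension R M h f = (\<Oplus>\<^bsub>M\<^esub>w\<in>B. f w \<odot>\<^bsub>M\<^esub> h w)"
  unfolding linear_extension_def
  using assms by (intro M.add.finprod_mono_neutral_cong_left) auto

lemma linear_extension_linear:
  fixes h :: "'g list \<Rightarrow> 'c"
  assumes h: "\<And>w. h w \<in> carrier M"
  shows "linear_map R (free_algebra R) M (linear_extension R M h)"
  unfolding linear_map_def
proof (intro conjI ballI)
  fix f :: "'g list \<Rightarrow> 'a" assume f: "f \<in> carrier (free_algebra R)"
  then show "linear_extension R M h f \<in> carrier M"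
    using h by (auto simp: linear_extension_def R.free_algebra_memD)
  fix g :: "'g list \<Rightarrow> 'a" assume g: "g \<in> carrier (free_algebra R)"
  let ?B = "{w. f w \<noteq> \<zero>} \<union> {w. g w \<noteq> \<zero>}"
  have fin: "finite ?B"
    using f g by (simp add: R.free_algebra_memD)
  have sub: "{w. (f \<oplus>\<^bsub>free_algebra R\<^esub> g) w \<noteq> \<zero>} \<subseteq> ?B"
    by (auto simp: R.free_add_apply)
  have "linear_extension R M h (f \<oplus>\<^bsub>free_algebra R\<^esub> g)
      = (\<Oplus>\<^bsub>M\<^esub>w\<in>?B. f w \<odot>\<^bsub>M\<^esub> h w \<oplus>\<^bsub>M\<^esub> g w \<odot>\<^bsub>M\<^esub> h w)"
    using linear_extension_superset[of h "f \<oplus>\<^bsub>free_algebra R\<^esub> g", OF h _ fin sub] f g h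
    by (simp add: R.free_add_apply R.free_algebra_memD smult_l_distr cong: M.finsum_cong)
  also have "\<dots> = (\<Oplus>\<^bsub>M\<^esub>w\<in>?B. f w \<odot>\<^bsub>M\<^esub> h w) \<oplus>\<^bsub>M\<^esub> (\<Oplus>\<^bsub>M\<^esub>w\<in>?B. g w \<odot>\<^bsub>M\<^esub> h w)"
    using f g h by (intro M.finsum_addf) (auto simp: R.free_algebra_memD)
  finally show "linear_extension R M h (f \<oplus>\<^bsub>free_algebra R\<^esub> g)
      = linear_extension R M h f \<oplus>\<^bsub>M\<^esub> linear_extension R M h g"
    using linear_extension_superset[of h f, OF h _ fin] linear_extension_superset[of h g, OF h _ fin] f g
    by (simp add: R.free_algebra_memD)
next
  fix c and f :: "'g list \<Rightarrow> 'a" assume c: "c \<in> carrier R" and f: "f \<in> carrier (free_algebra R)"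
  let ?B = "{w. f w \<noteq> \<zero>}"
  have fin: "finite ?B"
    using f by (simp add: R.free_algebra_memD)
  have sub: "{w. (c \<odot>\<^bsub>free_algebra R\<^esub> f) w \<noteq> \<zero>} \<subseteq> ?B"
    using c by (auto simp: R.free_smult_apply)
  have "linear_extension R M h (c \<odot>\<^bsub>free_algebra R\<^esub> f) = (\<Oplus>\<^bsub>M\<^esub>w\<in>?B. c \<odot>\<^bsub>M\<^esub> (f w \<odot>\<^bsub>M\<^esub> h w))"
    using linear_extension_superset[of h "c \<odot>\<^bsub>free_algebra R\<^esub> f", OF h _ fin sub] f c h
    by (simp add: R.free_smult_apply R.free_algebra_memD smult_assoc1 cong: M.finsum_cong)
  then show "linear_extension R M h (c \<odot>\<^bsub>free_algebra R\<^esub> f) = c \<odot>\<^bsub>M\<^esub> linear_extension R M h f"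
    using f c h fin
    by (simp add: linear_extension_def finsum_smult_ldistr Pi_def R.free_algebra_memD)
qed

lemma linear_extension_word:
  assumes h: "\<And>w. h w \<in> carrier M"
  shows "linear_extension R M h (free_word R u) = h u"
proof -
  have "linear_extension R M h (free_word R u) = (\<Oplus>\<^bsub>M\<^esub>w\<in>{u}. free_word R u w \<odot>\<^bsub>M\<^esub> h w)"
    by (rule linear_extension_superset) (auto simp: h free_word_def)
  then show ?thesis
    using h by (simp add: free_word_def)
qed

end

fun word_value :: "('a, 'm) ring_scheme \<Rightarrow> ('g \<Rightarrow> 'a) \<Rightarrow> 'g list \<Rightarrow> 'a" where
  "word_value N g [] = \<one>\<^bsub>N\<^esub>"
| "word_value N g (x # w) = g x \<otimes>\<^bsub>N\<^esub> word_value N g w"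

definition evaluation ::
    "('c, 'k) ring_scheme \<Rightarrow> ('c, 'a, 'm) module_scheme \<Rightarrow> ('g \<Rightarrow> 'a) \<Rightarrow> ('g list \<Rightarrow> 'c) \<Rightarrow> 'a" where
  "evaluation C N g = linear_extension C N (word_value N g)"

context assoc_algebra
begin

lemma linear_map_right_mult: "y \<in> carrier M \<Longrightarrow> linear_map R M M (\<lambda>x. x \<otimes>\<^bsub>M\<^esub> y)"
  by (simp add: linear_map_def smult_mult_left l_distr)

lemma linear_map_left_mult: "y \<in> carrier M \<Longrightarrow> linear_map R M M (\<lambda>x. y \<otimes>\<^bsub>M\<^esub> x)"
  by (simp add: linear_map_def smult_mult_right r_distr)

lemma word_value_closed: "(\<And>x. g x \<in> carrier M) \<Longrightarrow> word_value M g w \<in> carrier M"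
  by (induction w) auto

lemma word_value_append:
  "(\<And>x. g x \<in> carrier M) \<Longrightarrow> word_value M g (u @ v) = word_value M g u \<otimes>\<^bsub>M\<^esub> word_value M g v"
  by (induction u) (simp_all add: word_value_closed m_assoc)

context
  fixes g :: "'g \<Rightarrow> 'c"
  assumes g: "\<And>x. g x \<in> carrier M"
begin

lemma evaluation_linear: "linear_map R (free_algebra R) M (evaluation R M g)"
  unfolding evaluation_def by (rule linear_extension_linear) (simp add: word_value_closed g)

lemma evaluation_word: "evaluation R M g (free_word R w) = word_value M g w"
  unfolding evaluation_def by (rule linear_extension_word) (simp add: word_value_closed g)

lemma evaluation_mult:
  assumes "f \<in> carrier (free_algebra R)" "k \<in> carrier (free_algebra R)"
  shows "evaluation R M g (f \<otimes>\<^bsub>free_algebra R\<^esub> k) = evaluation R M g f \<otimes>\<^bsub>M\<^esub> evaluation R M g k"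
proof -
  interpret F: assoc_algebra R "free_algebra R :: ('a, 'g list \<Rightarrow> 'a) module"
    by (rule R.free_algebra_assoc_algebra)
  have E: "evaluation R M g x \<in> carrier M" if "x \<in> carrier (free_algebra R)" for x
    using evaluation_linear that by (simp add: linear_map_def)
  have word: "evaluation R M g (free_word R u \<otimes>\<^bsub>free_algebra R\<^esub> k)
      = evaluation R M g (free_word R u) \<otimes>\<^bsub>M\<^esub> evaluation R M g k" for u
  proof (rule linear_map_eqI[where S = UNIV, OF
        linear_map_comp[OF F.linear_map_left_mult evaluation_linear]
        linear_map_comp[OF evaluation_linear linear_map_left_mult]])
    fix v :: "'g list"
    show "evaluation R M g (free_word R u \<otimes>\<^bsub>free_algebra R\<^esub> free_word R v)
        = evaluation R M g (free_word R u) \<otimes>\<^bsub>M\<^esub> evaluation R M g (free_word R v)"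
      by (simp add: R.free_word_mult evaluation_word word_value_append g)
  qed (use assms in \<open>auto simp: R.free_word_closed E\<close>)
  show ?thesis
    by (rule linear_map_eqI[where S = UNIV, OF
        linear_map_comp[OF F.linear_map_right_mult evaluation_linear]
        linear_map_comp[OF evaluation_linear linear_map_right_mult]])
      (use assms in \<open>auto simp: word E\<close>)
qed

lemma evaluation_hom: "ring_hom_ring (free_algebra R) M (evaluation R M g)"
proof (rule ring_hom_ringI)
  interpret F: assoc_algebra R "free_algebra R :: ('a, 'g list \<Rightarrow> 'a) module"
    by (rule R.free_algebra_assoc_algebra)
  show "ring (free_algebra R :: ('a, 'g list \<Rightarrow> 'a) module)" "ring M"
    by (fact F.ring_axioms, fact ring_axioms)
  show "evaluation R M g \<one>\<^bsub>free_algebra R\<^esub> = \<one>\<^bsub>M\<^esub>"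
    by (simp add: R.free_one_word evaluation_word)
qed (use evaluation_linear in \<open>simp_all add: linear_map_def evaluation_mult\<close>)

end

end

section \<open>Quantum integers and factorials\<close>

lemma (in cring) q_int_closed [simp]: "q \<in> carrier R \<Longrightarrow> q_int R q n \<in> carrier R"
  by (simp add: q_int_def)

lemma (in cring) q_int_0: "q_int R q 0 = \<zero>"
  by (simp add: q_int_def)

lemma (in cring) q_int_Suc:
  assumes "q \<in> carrier R"
  shows "q_int R q (Suc n) = q_int R q n \<oplus> q [^] n"
  using assms by (simp add: q_int_def lessThan_Suc a_comm)

text \<open>
  This form matches the way \<open>\<theta>\<close> acts on powers of \<open>t\<close>, where \<open>\<theta>(t x) = x + q t \<theta>(x)\<close>.
\<close>

lemma (in cring) q_int_Suc':
  assumes "q \<in> carrier R"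
  shows "q_int R q (Suc n) = \<one> \<oplus> q \<otimes> q_int R q n"
proof (induction n)
  case 0
  then show ?case
    using assms by (simp add: q_int_Suc q_int_0)
next
  case (Suc n)
  have "q_int R q (Suc (Suc n)) = (\<one> \<oplus> q \<otimes> q_int R q n) \<oplus> q \<otimes> q [^] n"
    using assms Suc.IH q_int_Suc[of q "Suc n"] by (simp add: m_comm)
  then show ?case
    using assms by (simp add: q_int_Suc r_distr a_assoc)
qed

lemma (in cring) q_int_geometric:
  assumes "q \<in> carrier R"
  shows "q_int R q n \<otimes> (\<one> \<ominus> q) = \<one> \<ominus> q [^] n"
proof (induction n)
  case 0
  then show ?case
    using assms by (simp add: q_int_0 r_neg minus_eq)
next
  case (Suc n)
  have "q_int R q (Suc n) \<otimes> (\<one> \<ominus> q) = (\<one> \<ominus> q [^] n) \<oplus> q [^] n \<otimes> (\<one> \<ominus> q)"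
    using assms Suc.IH by (simp add: q_int_Suc l_distr)
  also have "\<dots> = \<one> \<ominus> q [^] n \<otimes> q"
  proof -
    have "q [^] n \<in> carrier R"
      using assms by simp
    then show ?thesis
      using assms by algebra
  qed
  finally show ?case
    by simp
qed

lemma (in "domain") q_int_nonzero:
  assumes "q \<in> carrier R" and "\<forall>n::nat. n > 0 \<longrightarrow> q [^] n \<noteq> \<one>" and "n > 0"
  shows "q_int R q n \<noteq> \<zero>"
proof
  assume "q_int R q n = \<zero>"
  then have "\<one> \<ominus> q [^] n = \<zero>"
    using assms(1) q_int_geometric[of q n] by (simp add: minus_eq)
  then show False
    using assms by (metis nat_pow_closed one_closed r_right_minus_eq)
qed

lemma (in cring) q_fact_closed [simp]: "q \<in> carrier R \<Longrightarrow> q_fact R q n \<in> carrier R"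
  by (simp add: q_fact_def Pi_def)

lemma (in cring) q_fact_0 [simp]: "q_fact R q 0 = \<one>"
  by (simp add: q_fact_def)

lemma (in cring) q_fact_Suc:
  assumes "q \<in> carrier R"
  shows "q_fact R q (Suc n) = q_int R q (Suc n) \<otimes> q_fact R q n"
proof -
  have "{1..Suc n} = insert (Suc n) {1..n}"
    by auto
  then show ?thesis
    using assms by (simp add: q_fact_def Pi_def)
qed

lemma (in "domain") q_fact_nonzero:
  assumes "q \<in> carrier R" and "\<forall>n::nat. n > 0 \<longrightarrow> q [^] n \<noteq> \<one>"
  shows "q_fact R q n \<noteq> \<zero>"
proof (induction n)
  case (Suc n)
  then show ?case
    using assms q_int_nonzero[OF assms, of "Suc n"]
    by (metis integral q_fact_Suc q_fact_closed q_int_closed zero_less_Suc)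
qed simp

lemma (in field) q_binomial_Suc_1:
  assumes "q \<in> carrier R" and "\<forall>n::nat. n > 0 \<longrightarrow> q [^] n \<noteq> \<one>"
  shows "q_binomial R q (Suc n) (Suc 0) = q_int R q (Suc n)"
proof -
  have 1: "q_fact R q (Suc 0) = \<one>"
    using assms(1) q_fact_Suc[of q 0] by (simp add: q_int_Suc q_int_0)
  have "q_fact R q n \<in> Units R"
    using assms q_fact_nonzero by (simp add: field_Units)
  then show ?thesis
    using assms(1) q_fact_Suc[of q n] by (simp add: q_binomial_def 1 m_assoc)
qed

section \<open>Semiconstants of a simple qsi algebra with a rational point\<close>

lemma (in ring) ideal_by_closure:
  assumes "I \<subseteq> carrier R" "\<zero> \<in> I"
    and "\<And>x y. \<lbrakk>x \<in> I; y \<in> I\<rbrakk> \<Longrightarrow> x \<oplus> y \<in> I"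
    and l: "\<And>x r. \<lbrakk>x \<in> I; r \<in> carrier R\<rbrakk> \<Longrightarrow> r \<otimes> x \<in> I"
    and r: "\<And>x r. \<lbrakk>x \<in> I; r \<in> carrier R\<rbrakk> \<Longrightarrow> x \<otimes> r \<in> I"
  shows "ideal I R"
proof (rule idealI[OF ring_axioms])
  have "\<ominus> x \<in> I" if "x \<in> I" for x
    using l[OF that, of "\<ominus> \<one>"] that assms(1) by (auto simp: l_minus)
  then show "subgroup I (add_monoid R)"
    using assms by (auto intro!: subgroup.intro simp: a_inv_def)
qed (use assms in auto)

lemma (in ideal) finsum_mem:
  assumes "finite B" "\<And>i. i \<in> B \<Longrightarrow> f i \<in> I"
  shows "(\<Oplus>i\<in>B. f i) \<in> I"
  using assms
proof (induction B rule: finite_induct)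
  case (insert b B)
  then have "f \<in> B \<rightarrow> carrier R" "f b \<in> carrier R"
    using a_subset by auto
  then show ?case
    using insert by (simp add: a_closed)
qed simp

text \<open>
  The parameter \<open>q\<close> is generic in the sense of quantum groups: it is not a root of unity.
\<close>

locale generic_qsi_algebra = qsi_algebra C q A
  for C :: "('c, 'k) ring_scheme" and q :: 'c and A :: "('c, 'a, 'm) qsi_scheme" (structure) +
  assumes field_C: "field C"
    and q_closed [simp]: "q \<in> carrier C"
    and q_nonzero: "q \<noteq> \<zero>\<^bsub>C\<^esub>"
    and q_not_root: "\<forall>n::nat. n > 0 \<longrightarrow> q [^]\<^bsub>C\<^esub> n \<noteq> \<one>\<^bsub>C\<^esub>"

sublocale generic_qsi_algebra \<subseteq> C: field C
  by (rule field_C)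

context generic_qsi_algebra
begin

lemma q_Units: "q \<in> Units C"
  using q_nonzero by (simp add: C.field_Units)

lemma inv_q_closed [simp]: "inv\<^bsub>C\<^esub> q \<in> carrier C"
  using q_Units by simp

lemma q_fact_Units: "q_fact C q n \<in> Units C"
  using C.q_fact_nonzero[OF q_closed q_not_root] by (simp add: C.field_Units)

lemma sigma_hom: "ring_hom_ring A A (qsigma A)"
  using sigma_auto ring_axioms by (simp add: ring_hom_ringI2 ring_iso_def)

sublocale sigma: ring_hom_ring A A "qsigma A"
  by (rule sigma_hom)

lemma sigma_linear: "linear_map C A A (qsigma A)"
  by (simp add: linear_map_def sigma_smult)

lemma theta_linear: "linear_map C A A (qtheta A i)"
  by (simp add: linear_map_def theta_closed theta_add theta_smult)

lemma theta1_mult: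
  assumes "a \<in> carrier A" "b \<in> carrier A"
  shows "qtheta A 1 (a \<otimes> b) = qtheta A 1 a \<otimes> b \<oplus> qsigma A a \<otimes> qtheta A 1 b"
proof -
  have "{..1} = {0, Suc 0}"
    by auto
  then show ?thesis
    using assms theta_mult[OF assms, of 1]
    by (simp add: theta_0 theta_closed Pi_def)
qed

lemma theta1_one: "qtheta A 1 \<one> = \<zero>"
proof -
  have "qtheta A 1 \<one> = qtheta A 1 \<one> \<oplus> qtheta A 1 \<one>"
    using theta1_mult[of \<one> \<one>] by (simp add: theta_closed)
  then show ?thesis
    by (simp add: theta_closed)
qed

lemma theta_zero: "qtheta A i \<zero> = \<zero>"
proof -
  have "qtheta A i (\<zero>\<^bsub>C\<^esub> \<odot> \<zero>) = \<zero>\<^bsub>C\<^esub> \<odot> qtheta A i \<zero>"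
    by (rule theta_smult) auto
  then show ?thesis
    by (simp add: theta_closed)
qed

text \<open>
  The composition rule gives \<open>\<theta>\<^sup>(\<^sup>1\<^sup>) \<theta>\<^sup>(\<^sup>m\<^sup>) = [m + 1]\<^sub>q \<theta>\<^sup>(\<^sup>m\<^sup>+\<^sup>1\<^sup>)\<close>. So \<open>\<theta>\<^sup>(\<^sup>1\<^sup>)\<close> determines all the operators, as
  it does by definition in the Picard-Vessiot ring.
\<close>

lemma theta1_iterate:
  assumes "x \<in> carrier A"
  shows "(qtheta A 1 ^^ m) x = q_fact C q m \<odot> qtheta A m x"
proof (induction m)
  case 0
  then show ?case
    using assms by (simp add: theta_0)
next
  case (Suc m)
  then have "(qtheta A 1 ^^ Suc m) x = q_fact C q m \<odot> (q_binomial C q (1 + m) 1 \<odot> qtheta A (1 + m) x)"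
    using assms by (simp add: theta_smult theta_closed theta_theta del: One_nat_def)
  also have "\<dots> = q_fact C q (Suc m) \<odot> qtheta A (Suc m) x"
    using assms
    by (simp add: C.q_binomial_Suc_1[OF q_closed q_not_root] R.q_fact_Suc R.m_comm theta_closed
        flip: smult_assoc1)
  finally show ?case .
qed

lemma theta_eq_iterate:
  assumes "x \<in> carrier A"
  shows "qtheta A m x = inv\<^bsub>C\<^esub> (q_fact C q m) \<odot> (qtheta A 1 ^^ m) x"
  using assms q_fact_Units[of m]
  by (simp add: theta1_iterate theta_closed del: One_nat_def flip: smult_assoc1)

lemma theta_constant:
  assumes "x \<in> carrier A" "qtheta A 1 x = \<zero>"
  shows "qtheta A (Suc m) x = \<zero>"
proof -
  have "(qtheta A 1 ^^ m) \<zero> = \<zero>"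
    by (induction m) (simp_all add: theta_zero)
  then have "(qtheta A 1 ^^ Suc m) x = \<zero>"
    using assms(2) by (simp add: funpow_swap1)
  then show ?thesis
    using assms(1) q_fact_Units[of "Suc m"] by (simp only: theta_eq_iterate) simp
qed

text \<open>
  For each operator, the elements of the ideal \<open>J\<close> generated by \<open>a\<close> that the operator sends to
  \<open>J\<close> form an ideal (for all \<open>\<theta>\<^sup>(\<^sup>i\<^sup>)\<close> together, by the twisted Leibniz rule, which also uses that
  \<open>\<sigma>\<close> preserves \<open>J\<close>). This ideal contains \<open>a\<close>, hence all of \<open>J\<close>.
\<close>

lemma semiconstant_ideal:
  assumes a: "a \<in> carrier A" and c: "c \<in> carrier C" "c \<noteq> \<zero>\<^bsub>C\<^esub>"
    and sigma_a: "qsigma A a = c \<odot> a" and theta_a: "qtheta A 1 a = \<zero>"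
  shows "qsi_ideal A (Idl {a})"
proof -
  let ?J = "Idl {a}"
  interpret J: ideal ?J A
    using a by (intro genideal_ideal) simp
  have aJ: "a \<in> ?J"
    using a genideal_self'[of a] by simp
  have minimal: "?J \<subseteq> K" if "ideal K A" "a \<in> K" for K
    using genideal_minimal[OF that(1)] that(2) by simp
  have smult: "d \<odot> x \<in> ?J" if "d \<in> carrier C" "x \<in> ?J" for d x
    using J.I_l_closed[OF that(2), of "d \<odot> \<one>"] that J.a_Hcarr[OF that(2)]
    by (simp add: smult_mult_left)
  have sigma: "qsigma A x \<in> ?J" if "x \<in> ?J" for x
  proof -
    have "ideal {x \<in> carrier A. qsigma A x \<in> ?J} A"
      by (rule ideal_by_closure) (auto simp: J.I_l_closed J.I_r_closed)
    then show ?thesis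
      using minimal[of "{x \<in> carrier A. qsigma A x \<in> ?J}"] a aJ c smult sigma_a that by auto
  qed
  have sigma_pow: "(qsigma A ^^ m) x \<in> ?J" if "x \<in> ?J" for m x
    using that sigma by (induction m) auto
  let ?s = "inv_into (carrier A) (qsigma A)"
  have sigma_inv: "?s x \<in> ?J" if "x \<in> ?J" for x
  proof -
    interpret s: ring_hom_ring A A ?s
      using ring_iso_set_sym[OF ring_axioms sigma_auto] ring_axioms
      by (simp add: ring_hom_ringI2 ring_iso_def)
    have "qsigma A (inv\<^bsub>C\<^esub> c \<odot> a) = a"
      using a c by (simp add: sigma_smult sigma_a C.field_Units flip: smult_assoc1)
    then have "?s a = inv\<^bsub>C\<^esub> c \<odot> a"
      using sigma_auto a c inv_into_f_f[of "qsigma A" "carrier A" "inv\<^bsub>C\<^esub> c \<odot> a"]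
      by (simp add: ring_iso_def bij_betw_def C.field_Units)
    moreover have "ideal {x \<in> carrier A. ?s x \<in> ?J} A"
      by (rule ideal_by_closure) (auto simp: J.I_l_closed J.I_r_closed)
    ultimately show ?thesis
      using minimal[of "{x \<in> carrier A. ?s x \<in> ?J}"] a aJ c smult that
      by (auto simp: C.field_Units)
  qed
  have theta: "qtheta A i x \<in> ?J" if "x \<in> ?J" for i x
  proof -
    let ?T = "{x \<in> ?J. \<forall>i. qtheta A i x \<in> ?J}"
    have "ideal ?T A"
    proof (rule ideal_by_closure)
      fix x r assume x: "x \<in> ?T" and r: "r \<in> carrier A"
      then have xA: "x \<in> carrier A"
        using J.a_Hcarr by simp
      have sig: "(qsigma A ^^ m) y \<in> carrier A" if "y \<in> carrier A" for m y
        using that by (induction m) auto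
      have "qtheta A i (r \<otimes> x) \<in> ?J" for i
        unfolding theta_mult[OF r xA]
        using x r by (intro J.finsum_mem J.I_l_closed) (auto intro: sig theta_closed)
      then show "r \<otimes> x \<in> ?T"
        using x r by (simp add: J.I_l_closed)
      have "qtheta A i (x \<otimes> r) \<in> ?J" for i
        unfolding theta_mult[OF xA r]
        using x r by (intro J.finsum_mem J.I_r_closed sigma_pow) (auto intro: theta_closed)
      then show "x \<otimes> r \<in> ?T"
        using x r by (simp add: J.I_r_closed)
    qed (auto simp: J.a_Hcarr theta_zero theta_add J.a_closed)
    moreover have "qtheta A i a \<in> ?J" for i
      by (cases i) (simp_all add: a aJ theta_0 theta_constant[OF a theta_a])
    ultimately show ?thesis
      using minimal[of ?T] aJ that by auto
  qed
  show ?thesis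
    unfolding qsi_ideal_def
    using J.ideal_axioms sigma sigma_inv theta by auto
qed

end

locale pointed_simple_qsi_algebra = generic_qsi_algebra C q A
  for C :: "('c, 'k) ring_scheme" and q :: 'c and A :: "('c, 'a, 'm) qsi_scheme" (structure) +
  fixes pt :: "'a \<Rightarrow> 'c"
  assumes simple: "qsi_simple A"
    and pt_hom: "pt \<in> ring_hom A C"
    and pt_smult: "\<lbrakk>c \<in> carrier C; x \<in> carrier A\<rbrakk> \<Longrightarrow> pt (c \<odot> x) = c \<otimes>\<^bsub>C\<^esub> pt x"

sublocale pointed_simple_qsi_algebra \<subseteq> pt: ring_hom_ring A C pt
  by (simp add: R.ring_axioms pt_hom ring_axioms ring_hom_ringI2)

context pointed_simple_qsi_algebra
begin

text \<open>
  The ideal generated by \<open>a\<close> is a qsi ideal inside the kernel of the point, hence proper.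
\<close>

lemma semiconstant_eq_zero:
  assumes a: "a \<in> carrier A" and c: "c \<in> carrier C" "c \<noteq> \<zero>\<^bsub>C\<^esub>"
    and "qsigma A a = c \<odot> a" "qtheta A 1 a = \<zero>" and pt_a: "pt a = \<zero>\<^bsub>C\<^esub>"
  shows "a = \<zero>"
proof -
  let ?J = "Idl {a}"
  have "?J \<subseteq> a_kernel A C pt"
  proof (rule genideal_minimal[OF pt.kernel_is_ideal])
    show "{a} \<subseteq> a_kernel A C pt"
      using a pt_a unfolding a_kernel_def' by simp
  qed
  moreover have "\<one> \<notin> a_kernel A C pt"
    unfolding a_kernel_def' by simp
  ultimately have "\<one> \<notin> ?J"
    by blast
  then have "?J = {\<zero>}"
    using simple semiconstant_ideal[OF assms(1-5)] unfolding qsi_simple_def by blast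
  then show ?thesis
    using a genideal_self'[of a] by simp
qed

text \<open>
  The rational point separates elements with the same weight and the same \<open>\<theta>\<close>. This makes the
  second row of \<open>Y\<close> scalar and yields the commutation rule \<open>Q t = q t Q\<close>.
\<close>

lemma semiconstant_eqI:
  assumes mem: "a \<in> carrier A" "b \<in> carrier A" and c: "c \<in> carrier C" "c \<noteq> \<zero>\<^bsub>C\<^esub>"
    and "qsigma A a = c \<odot> a" "qsigma A b = c \<odot> b" "qtheta A 1 a = qtheta A 1 b" "pt a = pt b"
  shows "a = b"
proof -
  have "qtheta A 1 (\<ominus> b) \<oplus> qtheta A 1 b = \<zero>"
    using mem theta_add[of "\<ominus> b" b 1] by (simp add: l_neg theta_zero)
  then have "qtheta A 1 (\<ominus> b) = \<ominus> qtheta A 1 b"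
    using mem by (simp add: minus_equality theta_closed)
  then have "qtheta A 1 (a \<ominus> b) = \<zero>"
    using assms by (simp add: minus_eq theta_add r_neg theta_closed del: One_nat_def)
  moreover have "qsigma A (a \<ominus> b) = c \<odot> (a \<ominus> b)"
    using assms by (simp add: minus_eq smult_r_distr smult_r_minus)
  moreover have "pt (a \<ominus> b) = \<zero>\<^bsub>C\<^esub>"
    using assms by (simp add: minus_eq R.r_neg)
  ultimately have "a \<ominus> b = \<zero>"
    using mem semiconstant_eq_zero[OF _ c, of "a \<ominus> b"] by (simp del: One_nat_def)
  then show ?thesis
    using mem by simp
qed

end

section \<open>The standard solution\<close>

text \<open>
  The data that a simple pointed algebra with a fundamental system is shown to contain: the
  solution matrix with rows \<open>(Q, t)\<close> and \<open>(0, 1)\<close>.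
\<close>

locale q_skew_triple = generic_qsi_algebra C q A
  for C :: "('c, 'k) ring_scheme" and q :: 'c and A :: "('c, 'a, 'm) qsi_scheme" (structure) +
  fixes t Q Qi :: 'a
  assumes triple_closed [simp]: "t \<in> carrier A" "Q \<in> carrier A" "Qi \<in> carrier A"
    and Q_Qi: "Q \<otimes> Qi = \<one>" and Qi_Q: "Qi \<otimes> Q = \<one>" and Q_t: "Q \<otimes> t = q \<odot> (t \<otimes> Q)"
    and sigma_Q: "qsigma A Q = q \<odot> Q" and sigma_t: "qsigma A t = q \<odot> t"
    and theta_Q: "qtheta A 1 Q = \<zero>" and theta_t: "qtheta A 1 t = \<one>"
    and nontrivial: "\<one> \<noteq> \<zero>"

context pointed_simple_qsi_algebra
begin

text \<open>
  With \<open>w = pt(Z)\<close>, where \<open>Z\<close> is the inverse of \<open>Y\<close>, the elements \<open>Q\<close> and \<open>t\<close> are the first row of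
  \<open>Y w\<close>; the second row is \<open>(0, 1)\<close>. Then \<open>Y = (Y w) pt(Y)\<close>, and \<open>pt(Y) Z\<close> is inverse to \<open>Y w\<close>, so
  its upper left entry \<open>Qi\<close> is inverse to \<open>Q\<close>. Solving these equations for the entries of \<open>Y\<close> and
  \<open>Z\<close> shows that they lie in every subalgebra containing \<open>t\<close>, \<open>Q\<close>, \<open>Qi\<close>.
\<close>

lemma q_skew_triple_exists:
  assumes "fundamental_system_M C q A Y Z"
  shows "\<exists>t Q Qi. q_skew_triple C q A t Q Qi \<and>
    (\<forall>S. subring S A \<longrightarrow> (\<lambda>c. c \<odot> \<one>) ` carrier C \<subseteq> S \<longrightarrow> {t, Q, Qi} \<subseteq> S \<longrightarrow>
       mat2_entries Y \<union> mat2_entries Z \<subseteq> S)"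
proof -
  define y1 y2 u1 u2 where y_def: "y1 = Y 1 1" "y2 = Y 1 2" "u1 = Y 2 1" "u2 = Y 2 2"
  define z11 z12 z21 z22 where z_def: "z11 = Z 1 1" "z12 = Z 1 2" "z21 = Z 2 1" "z22 = Z 2 2"
  have yA [simp]: "y1 \<in> carrier A" "y2 \<in> carrier A" "u1 \<in> carrier A" "u2 \<in> carrier A"
    and zA [simp]: "z11 \<in> carrier A" "z12 \<in> carrier A" "z21 \<in> carrier A" "z22 \<in> carrier A"
    using assms unfolding fundamental_system_M_def y_def z_def by auto
  have inv: "mat2_inverse A Y Z"
    using assms unfolding fundamental_system_M_def by blast
  have YZ: "y1 \<otimes> z11 \<oplus> y2 \<otimes> z21 = \<one>" "y1 \<otimes> z12 \<oplus> y2 \<otimes> z22 = \<zero>"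
      "u1 \<otimes> z11 \<oplus> u2 \<otimes> z21 = \<zero>" "u1 \<otimes> z12 \<oplus> u2 \<otimes> z22 = \<one>"
    and ZY: "z11 \<otimes> y1 \<oplus> z12 \<otimes> u1 = \<one>" "z11 \<otimes> y2 \<oplus> z12 \<otimes> u2 = \<zero>"
      "z21 \<otimes> y1 \<oplus> z22 \<otimes> u1 = \<zero>" "z21 \<otimes> y2 \<oplus> z22 \<otimes> u2 = \<one>"
    using inv yA zA unfolding mat2_inverse_def y_def z_def
    by (simp_all add: Pi_def del: One_nat_def)
  have sigma_y: "qsigma A y1 = q \<odot> y1" "qsigma A y2 = q \<odot> y2"
      "qsigma A u1 = u1" "qsigma A u2 = u2"
    and theta_y: "qtheta A 1 y1 = u1" "qtheta A 1 y2 = u2" "qtheta A 1 u1 = \<zero>" "qtheta A 1 u2 = \<zero>"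
    using assms yA unfolding fundamental_system_M_def y_def
    by (simp_all add: Pi_def M_sigma_def M_theta_def del: One_nat_def)
  have theta_scalar: "qtheta A 1 (c \<odot> \<one>) = \<zero>" if "c \<in> carrier C" for c
    using that by (simp add: theta_smult theta1_one del: One_nat_def)
  define b1 b2 c1 c2 where b_def: "b1 = pt y1" "b2 = pt y2" "c1 = pt u1" "c2 = pt u2"
  define w11 w12 w21 w22 where w_def: "w11 = pt z11" "w12 = pt z12" "w21 = pt z21" "w22 = pt z22"
  have bC [simp]: "b1 \<in> carrier C" "b2 \<in> carrier C" "c1 \<in> carrier C" "c2 \<in> carrier C"
    and wC [simp]: "w11 \<in> carrier C" "w12 \<in> carrier C" "w21 \<in> carrier C" "w22 \<in> carrier C"
    by (simp_all add: b_def w_def)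
  have u: "u1 = c1 \<odot> \<one>" "u2 = c2 \<odot> \<one>"
    by (rule semiconstant_eqI[of _ _ "\<one>\<^bsub>C\<^esub>"];
        simp add: sigma_smult sigma_y theta_y theta_scalar pt_smult b_def del: One_nat_def)+
  have bw: "b1 \<otimes>\<^bsub>C\<^esub> w11 \<oplus>\<^bsub>C\<^esub> b2 \<otimes>\<^bsub>C\<^esub> w21 = \<one>\<^bsub>C\<^esub>" "b1 \<otimes>\<^bsub>C\<^esub> w12 \<oplus>\<^bsub>C\<^esub> b2 \<otimes>\<^bsub>C\<^esub> w22 = \<zero>\<^bsub>C\<^esub>"
      "c1 \<otimes>\<^bsub>C\<^esub> w11 \<oplus>\<^bsub>C\<^esub> c2 \<otimes>\<^bsub>C\<^esub> w21 = \<zero>\<^bsub>C\<^esub>" "c1 \<otimes>\<^bsub>C\<^esub> w12 \<oplus>\<^bsub>C\<^esub> c2 \<otimes>\<^bsub>C\<^esub> w22 = \<one>\<^bsub>C\<^esub>"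
    using YZ[THEN arg_cong[where f = pt]] by (simp_all add: b_def w_def)
  have wb: "w11 \<otimes>\<^bsub>C\<^esub> b1 \<oplus>\<^bsub>C\<^esub> w12 \<otimes>\<^bsub>C\<^esub> c1 = \<one>\<^bsub>C\<^esub>" "w11 \<otimes>\<^bsub>C\<^esub> b2 \<oplus>\<^bsub>C\<^esub> w12 \<otimes>\<^bsub>C\<^esub> c2 = \<zero>\<^bsub>C\<^esub>"
      "w21 \<otimes>\<^bsub>C\<^esub> b1 \<oplus>\<^bsub>C\<^esub> w22 \<otimes>\<^bsub>C\<^esub> c1 = \<zero>\<^bsub>C\<^esub>" "w21 \<otimes>\<^bsub>C\<^esub> b2 \<oplus>\<^bsub>C\<^esub> w22 \<otimes>\<^bsub>C\<^esub> c2 = \<one>\<^bsub>C\<^esub>"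
    using ZY[THEN arg_cong[where f = pt]] by (simp_all add: b_def w_def)

  \<comment> \<open>The first row of \<open>Y\<close> times the column \<open>(a, b)\<close> of scalars. The second row times the same
    column is the scalar \<open>c1 a + c2 b\<close> that occurs in \<open>theta_comb\<close> and \<open>mult_comb\<close>.\<close>
  define comb where "comb a b = a \<odot> y1 \<oplus> b \<odot> y2" for a b
  have comb_closed [simp]: "comb a b \<in> carrier A" if "a \<in> carrier C" "b \<in> carrier C" for a b
    using that by (simp add: comb_def)
  have sigma_comb: "qsigma A (comb a b) = q \<odot> comb a b" if "a \<in> carrier C" "b \<in> carrier C" for a b
    using that
    by (simp add: comb_def sigma_smult sigma_y smult_r_distr R.m_comm flip: smult_assoc1)
  have theta_comb: "qtheta A 1 (comb a b) = (c1 \<otimes>\<^bsub>C\<^esub> a \<oplus>\<^bsub>C\<^esub> c2 \<otimes>\<^bsub>C\<^esub> b) \<odot> \<one>"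
    if "a \<in> carrier C" "b \<in> carrier C" for a b
    using that
    by (simp add: comb_def theta_add theta_smult theta_y u smult_l_distr R.m_comm del: One_nat_def
        flip: smult_assoc1)
  have pt_comb: "pt (comb a b) = b1 \<otimes>\<^bsub>C\<^esub> a \<oplus>\<^bsub>C\<^esub> b2 \<otimes>\<^bsub>C\<^esub> b"
    if "a \<in> carrier C" "b \<in> carrier C" for a b
    using that by (simp add: comb_def pt_smult b_def R.m_comm)
  have mult_comb: "x \<otimes> comb a b \<oplus> (c1 \<otimes>\<^bsub>C\<^esub> a \<oplus>\<^bsub>C\<^esub> c2 \<otimes>\<^bsub>C\<^esub> b) \<odot> x'
      = a \<odot> (x \<otimes> y1 \<oplus> x' \<otimes> u1) \<oplus> b \<odot> (x \<otimes> y2 \<oplus> x' \<otimes> u2)"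
    if "a \<in> carrier C" "b \<in> carrier C" "x \<in> carrier A" "x' \<in> carrier A" for a b x x'
    using that
    by (simp add: comb_def u smult_mult_right r_distr smult_r_distr smult_l_distr R.m_comm a_ac
        flip: smult_assoc1)

  define Q where "Q = comb w11 w21"
  define t where "t = comb w12 w22"
  define Qi where "Qi = b1 \<odot> z11 \<oplus> b2 \<odot> z21"
  have closed [simp]: "Q \<in> carrier A" "t \<in> carrier A" "Qi \<in> carrier A"
    by (simp_all add: Q_def t_def Qi_def)
  have y1_eq: "b1 \<odot> Q \<oplus> c1 \<odot> t = y1"
  proof -
    have "b1 \<odot> Q \<oplus> c1 \<odot> t = (w11 \<otimes>\<^bsub>C\<^esub> b1 \<oplus>\<^bsub>C\<^esub> w12 \<otimes>\<^bsub>C\<^esub> c1) \<odot> y1 \<oplus> (w21 \<otimes>\<^bsub>C\<^esub> b1 \<oplus>\<^bsub>C\<^esub> w22 \<otimes>\<^bsub>C\<^esub> c1) \<odot> y2"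
      by (simp add: Q_def t_def comb_def smult_r_distr smult_l_distr R.m_comm a_ac flip: smult_assoc1)
    then show ?thesis
      by (simp add: wb)
  qed
  have y2_eq: "b2 \<odot> Q \<oplus> c2 \<odot> t = y2"
  proof -
    have "b2 \<odot> Q \<oplus> c2 \<odot> t = (w11 \<otimes>\<^bsub>C\<^esub> b2 \<oplus>\<^bsub>C\<^esub> w12 \<otimes>\<^bsub>C\<^esub> c2) \<odot> y1 \<oplus> (w21 \<otimes>\<^bsub>C\<^esub> b2 \<oplus>\<^bsub>C\<^esub> w22 \<otimes>\<^bsub>C\<^esub> c2) \<odot> y2"
      by (simp add: Q_def t_def comb_def smult_r_distr smult_l_distr R.m_comm a_ac flip: smult_assoc1)
    then show ?thesis
      by (simp add: wb)
  qed
  \<comment> \<open>\<open>mult_comb\<close> for \<open>Q\<close> and \<open>t\<close>: the scalar \<open>c1 a + c2 b\<close> is \<open>0\<close>, respectively \<open>1\<close>.\<close>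
  have z_Q: "z11 \<otimes> Q = w11 \<odot> \<one>" "z21 \<otimes> Q = w21 \<odot> \<one>"
    using mult_comb[of w11 w21 z11 z12] mult_comb[of w11 w21 z21 z22] by (simp_all add: Q_def bw ZY)
  have z_t: "z11 \<otimes> t \<oplus> z12 = w12 \<odot> \<one>" "z21 \<otimes> t \<oplus> z22 = w22 \<odot> \<one>"
    using mult_comb[of w12 w22 z11 z12] mult_comb[of w12 w22 z21 z22] by (simp_all add: t_def bw ZY)
  have Q_Qi: "Q \<otimes> Qi = \<one>"
  proof -
    \<comment> \<open>The factor next to \<open>t\<close> is an off-diagonal entry of \<open>Y Z = 1\<close>.\<close>
    have "Q \<otimes> Qi \<oplus> t \<otimes> (u1 \<otimes> z11 \<oplus> u2 \<otimes> z21)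
        = (b1 \<odot> Q \<oplus> c1 \<odot> t) \<otimes> z11 \<oplus> (b2 \<odot> Q \<oplus> c2 \<odot> t) \<otimes> z21"
      by (simp add: Qi_def u l_distr r_distr smult_mult_left smult_mult_right a_ac)
    then show ?thesis
      by (simp add: y1_eq y2_eq YZ)
  qed
  have Qi_Q: "Qi \<otimes> Q = \<one>"
    by (simp add: Qi_def l_distr smult_mult_left z_Q bw flip: smult_assoc1 smult_l_distr)
  have z_Qi: "z11 = w11 \<odot> Qi" "z21 = w21 \<odot> Qi"
    using z_Q[THEN arg_cong[where f = "\<lambda>x. x \<otimes> Qi"]]
    by (simp_all add: m_assoc Q_Qi smult_mult_left)
  have Q_t: "Q \<otimes> t = q \<odot> (t \<otimes> Q)"
  proof (rule semiconstant_eqI[of _ _ "q \<otimes>\<^bsub>C\<^esub> q"])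
    show "q \<otimes>\<^bsub>C\<^esub> q \<noteq> \<zero>\<^bsub>C\<^esub>"
      using q_nonzero C.integral[of q q] by auto
    show "qtheta A 1 (Q \<otimes> t) = qtheta A 1 (q \<odot> (t \<otimes> Q))"
      by (simp add: Q_def t_def theta_smult theta1_mult theta_comb sigma_comb bw smult_mult_left
          del: One_nat_def)
    show "pt (Q \<otimes> t) = pt (q \<odot> (t \<otimes> Q))"
      by (simp add: Q_def t_def pt_comb pt_smult bw)
  qed (simp_all add: Q_def t_def sigma_smult sigma_comb smult_mult_left smult_mult_right smult_assoc1)
  have "\<one> \<noteq> \<zero>"
    using pt.hom_one pt.hom_zero by (metis C.one_not_zero)
  moreover have "qsigma A Q = q \<odot> Q" "qsigma A t = q \<odot> t"
    by (simp_all add: Q_def t_def sigma_comb)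
  moreover have "qtheta A 1 Q = \<zero>" "qtheta A 1 t = \<one>"
    by (simp_all add: Q_def t_def theta_comb bw del: One_nat_def)
  ultimately have "q_skew_triple C q A t Q Qi"
    using Q_Qi Qi_Q Q_t closed generic_qsi_algebra_axioms
    by (intro q_skew_triple.intro q_skew_triple_axioms.intro)
  moreover have "mat2_entries Y \<union> mat2_entries Z \<subseteq> S"
    if S: "subring S A" "(\<lambda>c. c \<odot> \<one>) ` carrier C \<subseteq> S" "{t, Q, Qi} \<subseteq> S" for S
  proof -
    have sub: "S \<subseteq> carrier A"
      using S(1) by (rule subringE)
    have add: "x \<oplus> y \<in> S" and mult: "x \<otimes> y \<in> S" if "x \<in> S" "y \<in> S" for x y
      using subringE(6,7)[OF S(1)] that by auto
    have scalar: "c \<odot> \<one> \<in> S" if "c \<in> carrier C" for c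
      using S(2) that by auto
    have smult: "c \<odot> x \<in> S" if "c \<in> carrier C" "x \<in> S" for c x
      using mult[OF scalar[OF that(1)] that(2)] that sub by (auto simp: smult_mult_left)
    have gen: "t \<in> S" "Q \<in> S" "Qi \<in> S"
      using S(3) by auto
    have y: "y1 \<in> S" "y2 \<in> S" "u1 \<in> S" "u2 \<in> S"
      using gen by (auto simp: u scalar simp flip: y1_eq y2_eq intro!: add smult)
    have z1: "z11 \<in> S" "z21 \<in> S"
      using gen by (auto simp: z_Qi intro!: smult)
    have "z12 = w12 \<odot> \<one> \<ominus> z11 \<otimes> t" "z22 = w22 \<odot> \<one> \<ominus> z21 \<otimes> t"
      by (simp_all flip: z_t add: minus_eq a_ac r_neg r_neg1 r_neg2)
    moreover have neg: "\<ominus> x \<in> S" if "x \<in> S" for x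
      using subringE(5)[OF S(1)] that .
    ultimately have z2: "z12 \<in> S" "z22 \<in> S"
      using add[OF scalar neg[OF mult[OF z1(1) gen(1)]], of w12]
        add[OF scalar neg[OF mult[OF z1(2) gen(1)]], of w22]
      by (simp_all add: minus_eq)
    show ?thesis
      using y z1 z2 unfolding mat2_entries_def y_def z_def by auto
  qed
  ultimately show ?thesis
    by blast
qed

end

section \<open>Normal forms modulo the defining relations\<close>

text \<open>
  The word of the monomial \<open>t\<^sup>i Q\<^sup>n\<close>. Only non-negative powers of \<open>Q\<close> occur: negative ones are cleared
  by multiplying with a power of \<open>Q\<close>, a unit modulo the relations.
\<close>

definition normal_word :: "nat \<Rightarrow> nat \<Rightarrow> pv_gen list" where
  "normal_word i n = replicate i Gen_t @ replicate n Gen_Q"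

definition normal_words :: "pv_gen list set" where
  "normal_words = {normal_word i n | i n. True}"

lemma normal_word_Suc: "normal_word (Suc i) n = Gen_t # normal_word i n"
  and normal_word_0: "normal_word 0 n = replicate n Gen_Q"
  by (simp_all add: normal_word_def)

lemma normal_word_in [simp]: "normal_word i n \<in> normal_words"
  by (auto simp: normal_words_def)

locale q_plane_presentation = cring C
  for C :: "('c, 'k) ring_scheme" (structure) +
  fixes q :: 'c
  assumes q_in [simp]: "q \<in> carrier C"

sublocale q_plane_presentation \<subseteq> F: assoc_algebra C "pv_free C"
  by (rule free_algebra_assoc_algebra)

context q_plane_presentation
begin

abbreviation W :: "pv_gen list \<Rightarrow> pv_gen list \<Rightarrow> 'c" where
  "W \<equiv> free_word C"

abbreviation coset :: "(pv_gen list \<Rightarrow> 'c) \<Rightarrow> (pv_gen list \<Rightarrow> 'c) set" where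
  "coset x \<equiv> pv_ideal C q +>\<^bsub>pv_free C\<^esub> x"

lemma W_closed [simp]: "W w \<in> carrier (pv_free C)"
  by (rule free_word_closed)

lemma relations_closed: "pv_relations C q \<subseteq> carrier (pv_free C)"
  by (simp add: pv_relations_def)

sublocale I: ideal "pv_ideal C q" "pv_free C"
  unfolding pv_ideal_def using relations_closed by (rule F.genideal_ideal)

text \<open>
  Congruence modulo the ideal is expressed as equality of cosets, so that it is used like an equation.
\<close>

lemma relation_coset_eq:
  assumes "x \<in> carrier (pv_free C)" "y \<in> carrier (pv_free C)" "x \<ominus>\<^bsub>pv_free C\<^esub> y \<in> pv_relations C q"
  shows "coset x = coset y"
proof -
  have "x \<ominus>\<^bsub>pv_free C\<^esub> y \<in> pv_ideal C q"
    using assms(3) F.genideal_self[OF relations_closed] unfolding pv_ideal_def by blast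
  then show ?thesis
    using F.quotient_eq_iff_same_a_r_cos[OF I.ideal_axioms assms(1,2)] by simp
qed

lemma coset_Q_t: "coset (W [Gen_Q, Gen_t]) = coset (q \<odot>\<^bsub>pv_free C\<^esub> W [Gen_t, Gen_Q])"
  and coset_Q_Qi: "coset (W [Gen_Q, Gen_Qinv]) = coset \<one>\<^bsub>pv_free C\<^esub>"
  and coset_Qi_Q: "coset (W [Gen_Qinv, Gen_Q]) = coset \<one>\<^bsub>pv_free C\<^esub>"
  by (rule relation_coset_eq; simp add: pv_relations_def)+

lemma coset_mult:
  assumes "coset x = coset x'" "coset y = coset y'"
    and "x \<in> carrier (pv_free C)" "x' \<in> carrier (pv_free C)"
        "y \<in> carrier (pv_free C)" "y' \<in> carrier (pv_free C)"
  shows "coset (x \<otimes>\<^bsub>pv_free C\<^esub> y) = coset (x' \<otimes>\<^bsub>pv_free C\<^esub> y')"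
  using assms by (metis I.rcoset_mult_add)

lemma coset_add:
  assumes "coset x = coset x'" "coset y = coset y'"
    and "x \<in> carrier (pv_free C)" "x' \<in> carrier (pv_free C)"
        "y \<in> carrier (pv_free C)" "y' \<in> carrier (pv_free C)"
  shows "coset (x \<oplus>\<^bsub>pv_free C\<^esub> y) = coset (x' \<oplus>\<^bsub>pv_free C\<^esub> y')"
  using assms by (metis I.a_rcos_sum)

lemma coset_smult:
  assumes "coset x = coset x'" "c \<in> carrier C"
    and "x \<in> carrier (pv_free C)" "x' \<in> carrier (pv_free C)"
  shows "coset (c \<odot>\<^bsub>pv_free C\<^esub> x) = coset (c \<odot>\<^bsub>pv_free C\<^esub> x')"
  using coset_mult[OF refl assms(1), of "c \<odot>\<^bsub>pv_free C\<^esub> \<one>\<^bsub>pv_free C\<^esub>"] assms(2-)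
  by (simp add: F.smult_mult_left)

lemma coset_Q_normal_word:
  "coset (W [Gen_Q] \<otimes>\<^bsub>pv_free C\<^esub> W (normal_word i n))
     = coset (q [^] i \<odot>\<^bsub>pv_free C\<^esub> W (normal_word i (Suc n)))"
proof (induction i)
  case 0
  have "W [Gen_Q] \<otimes>\<^bsub>pv_free C\<^esub> W (normal_word 0 n) = W (normal_word 0 (Suc n))"
    by (simp add: free_word_mult normal_word_0)
  then show ?case
    by simp
next
  case (Suc i)
  have "coset (W [Gen_Q] \<otimes>\<^bsub>pv_free C\<^esub> W (normal_word (Suc i) n))
      = coset (W [Gen_Q, Gen_t] \<otimes>\<^bsub>pv_free C\<^esub> W (normal_word i n))"
    by (simp add: free_word_mult normal_word_Suc)
  also have "\<dots> = coset ((q \<odot>\<^bsub>pv_free C\<^esub> W [Gen_t, Gen_Q]) \<otimes>\<^bsub>pv_free C\<^esub> W (normal_word i n))"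
    by (rule coset_mult) (simp_all add: coset_Q_t)
  also have "(q \<odot>\<^bsub>pv_free C\<^esub> W [Gen_t, Gen_Q]) \<otimes>\<^bsub>pv_free C\<^esub> W (normal_word i n)
      = (q \<odot>\<^bsub>pv_free C\<^esub> W [Gen_t]) \<otimes>\<^bsub>pv_free C\<^esub> (W [Gen_Q] \<otimes>\<^bsub>pv_free C\<^esub> W (normal_word i n))"
    by (simp add: F.smult_mult_left free_word_mult)
  also have "coset \<dots> = coset ((q \<odot>\<^bsub>pv_free C\<^esub> W [Gen_t]) \<otimes>\<^bsub>pv_free C\<^esub> (q [^] i \<odot>\<^bsub>pv_free C\<^esub> W (normal_word i (Suc n))))"
    by (rule coset_mult) (simp_all add: Suc.IH)
  also have "(q \<odot>\<^bsub>pv_free C\<^esub> W [Gen_t]) \<otimes>\<^bsub>pv_free C\<^esub> (q [^] i \<odot>\<^bsub>pv_free C\<^esub> W (normal_word i (Suc n)))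
      = q [^] Suc i \<odot>\<^bsub>pv_free C\<^esub> W (normal_word (Suc i) (Suc n))"
    by (simp add: F.smult_mult_left F.smult_mult_right free_word_mult normal_word_Suc m_comm
        flip: F.smult_assoc1)
  finally show ?case .
qed

definition normal_elements :: "(pv_gen list \<Rightarrow> 'c) set" where
  "normal_elements = {z \<in> carrier (pv_free C). {w. z w \<noteq> \<zero>} \<subseteq> normal_words}"

lemma normal_elements_closed: "z \<in> normal_elements \<Longrightarrow> z \<in> carrier (pv_free C)"
  by (simp add: normal_elements_def)

lemma normal_elements_zero: "\<zero>\<^bsub>pv_free C\<^esub> \<in> normal_elements"
  by (simp add: normal_elements_def free_zero_apply)

lemma normal_elements_word: "w \<in> normal_words \<Longrightarrow> W w \<in> normal_elements"
  using W_closed[of w] by (auto simp: normal_elements_def free_word_def)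

lemma normal_elements_add:
  assumes "x \<in> normal_elements" "y \<in> normal_elements"
  shows "x \<oplus>\<^bsub>pv_free C\<^esub> y \<in> normal_elements"
proof -
  have "{w. (x \<oplus>\<^bsub>pv_free C\<^esub> y) w \<noteq> \<zero>} \<subseteq> {w. x w \<noteq> \<zero>} \<union> {w. y w \<noteq> \<zero>}"
    by (auto simp: free_add_apply)
  then show ?thesis
    using assms by (auto simp: normal_elements_def)
qed

lemma normal_elements_smult:
  assumes "c \<in> carrier C" "x \<in> normal_elements"
  shows "c \<odot>\<^bsub>pv_free C\<^esub> x \<in> normal_elements"
proof -
  have "{w. (c \<odot>\<^bsub>pv_free C\<^esub> x) w \<noteq> \<zero>} \<subseteq> {w. x w \<noteq> \<zero>}"
    using assms(1) by (auto simp: free_smult_apply)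
  then show ?thesis
    using assms by (auto simp: normal_elements_def)
qed

text \<open>
  By linearity it suffices to bring a product \<open>u w\<close> into normal form for normal words \<open>w\<close>.
\<close>

lemma normal_left_mult:
  assumes "u \<in> carrier (pv_free C)"
    and word: "\<And>w. w \<in> normal_words \<Longrightarrow> \<exists>z \<in> normal_elements. coset (u \<otimes>\<^bsub>pv_free C\<^esub> W w) = coset z"
    and "z \<in> normal_elements"
  shows "\<exists>z' \<in> normal_elements. coset (u \<otimes>\<^bsub>pv_free C\<^esub> z) = coset z'"
proof -
  have "z \<in> carrier (pv_free C)" "{w. z w \<noteq> \<zero>} \<subseteq> normal_words"
    using assms(3) by (simp_all add: normal_elements_def)
  then show ?thesis
  proof (induction z rule: free_algebra_induct)
    case zero
    then show ?case
      using assms(1) by (intro bexI[OF _ normal_elements_zero]) simp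
  next
    case (add f c w)
    then obtain z1 z2 where z: "z1 \<in> normal_elements" "coset (u \<otimes>\<^bsub>pv_free C\<^esub> f) = coset z1"
      "z2 \<in> normal_elements" "coset (u \<otimes>\<^bsub>pv_free C\<^esub> W w) = coset z2"
      using word by blast
    have "coset (c \<odot>\<^bsub>pv_free C\<^esub> (u \<otimes>\<^bsub>pv_free C\<^esub> W w)) = coset (c \<odot>\<^bsub>pv_free C\<^esub> z2)"
      using z add.hyps assms(1) by (intro coset_smult) (simp_all add: normal_elements_closed)
    then have "coset (u \<otimes>\<^bsub>pv_free C\<^esub> f \<oplus>\<^bsub>pv_free C\<^esub> c \<odot>\<^bsub>pv_free C\<^esub> (u \<otimes>\<^bsub>pv_free C\<^esub> W w))
        = coset (z1 \<oplus>\<^bsub>pv_free C\<^esub> c \<odot>\<^bsub>pv_free C\<^esub> z2)"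
      using z add.hyps assms(1) by (intro coset_add) (simp_all add: normal_elements_closed)
    then show ?case
      using z add.hyps assms(1)
      by (intro bexI[of _ "z1 \<oplus>\<^bsub>pv_free C\<^esub> c \<odot>\<^bsub>pv_free C\<^esub> z2"] normal_elements_add normal_elements_smult)
        (simp_all add: F.r_distr F.smult_mult_right)
  qed
qed

lemma normal_Q_mult:
  assumes "z \<in> normal_elements"
  shows "\<exists>z' \<in> normal_elements. coset (W [Gen_Q] \<otimes>\<^bsub>pv_free C\<^esub> z) = coset z'"
proof (rule normal_left_mult[OF _ _ assms])
  fix w assume "w \<in> normal_words"
  then obtain i n where "w = normal_word i n"
    by (auto simp: normal_words_def)
  then show "\<exists>z \<in> normal_elements. coset (W [Gen_Q] \<otimes>\<^bsub>pv_free C\<^esub> W w) = coset z"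
    using coset_Q_normal_word[of i n]
    by (auto intro!: bexI[OF _ normal_elements_smult[OF _ normal_elements_word]])
qed simp

lemma normal_t_mult:
  assumes "z \<in> normal_elements"
  shows "\<exists>z' \<in> normal_elements. coset (W [Gen_t] \<otimes>\<^bsub>pv_free C\<^esub> z) = coset z'"
proof (rule normal_left_mult[OF _ _ assms])
  fix w assume "w \<in> normal_words"
  then obtain i n where "w = normal_word i n"
    by (auto simp: normal_words_def)
  then show "\<exists>z \<in> normal_elements. coset (W [Gen_t] \<otimes>\<^bsub>pv_free C\<^esub> W w) = coset z"
    by (intro bexI[of _ "W (normal_word (Suc i) n)"] normal_elements_word)
      (simp_all add: free_word_mult flip: normal_word_Suc)
qed simp

abbreviation Qpow :: "nat \<Rightarrow> pv_gen list \<Rightarrow> 'c" where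
  "Qpow N \<equiv> W (replicate N Gen_Q)"

lemma Qpow_Suc: "Qpow (Suc N) = W [Gen_Q] \<otimes>\<^bsub>pv_free C\<^esub> Qpow N"
  by (simp add: free_word_mult)

lemma normal_Qpow_mult:
  assumes "z \<in> normal_elements"
  shows "\<exists>z' \<in> normal_elements. coset (Qpow N \<otimes>\<^bsub>pv_free C\<^esub> z) = coset z'"
proof (induction N)
  case 0
  have "Qpow 0 \<otimes>\<^bsub>pv_free C\<^esub> z = z"
    using assms by (simp add: normal_elements_closed flip: free_one_word)
  then show ?case
    using assms by (intro bexI[of _ z]) simp_all
next
  case (Suc N)
  then obtain z' where z': "z' \<in> normal_elements" "coset (Qpow N \<otimes>\<^bsub>pv_free C\<^esub> z) = coset z'"
    by blast
  have "coset (Qpow (Suc N) \<otimes>\<^bsub>pv_free C\<^esub> z) = coset (W [Gen_Q] \<otimes>\<^bsub>pv_free C\<^esub> (Qpow N \<otimes>\<^bsub>pv_free C\<^esub> z))"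
    using assms by (simp only: Qpow_Suc) (simp add: F.m_assoc normal_elements_closed)
  also have "\<dots> = coset (W [Gen_Q] \<otimes>\<^bsub>pv_free C\<^esub> z')"
    using z' assms by (intro coset_mult) (simp_all add: normal_elements_closed)
  finally show ?case
    using normal_Q_mult[OF z'(1)] by simp
qed

lemma coset_Qpow_t:
  "coset (Qpow N \<otimes>\<^bsub>pv_free C\<^esub> W [Gen_t]) = coset (q [^] N \<odot>\<^bsub>pv_free C\<^esub> (W [Gen_t] \<otimes>\<^bsub>pv_free C\<^esub> Qpow N))"
proof (induction N)
  case 0
  then show ?case
    by (simp add: free_word_mult)
next
  case (Suc N)
  have "coset (Qpow (Suc N) \<otimes>\<^bsub>pv_free C\<^esub> W [Gen_t]) = coset (Qpow N \<otimes>\<^bsub>pv_free C\<^esub> W [Gen_Q, Gen_t])"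
    by (simp add: free_word_mult replicate_app_Cons_same)
  also have "\<dots> = coset (Qpow N \<otimes>\<^bsub>pv_free C\<^esub> (q \<odot>\<^bsub>pv_free C\<^esub> W [Gen_t, Gen_Q]))"
    by (rule coset_mult) (simp_all add: coset_Q_t)
  also have "Qpow N \<otimes>\<^bsub>pv_free C\<^esub> (q \<odot>\<^bsub>pv_free C\<^esub> W [Gen_t, Gen_Q])
      = (Qpow N \<otimes>\<^bsub>pv_free C\<^esub> W [Gen_t]) \<otimes>\<^bsub>pv_free C\<^esub> (q \<odot>\<^bsub>pv_free C\<^esub> W [Gen_Q])"
    by (simp add: F.smult_mult_right free_word_mult)
  also have "coset \<dots> = coset ((q [^] N \<odot>\<^bsub>pv_free C\<^esub> (W [Gen_t] \<otimes>\<^bsub>pv_free C\<^esub> Qpow N)) \<otimes>\<^bsub>pv_free C\<^esub> (q \<odot>\<^bsub>pv_free C\<^esub> W [Gen_Q]))"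
    by (rule coset_mult) (simp_all add: Suc.IH)
  also have "(q [^] N \<odot>\<^bsub>pv_free C\<^esub> (W [Gen_t] \<otimes>\<^bsub>pv_free C\<^esub> Qpow N)) \<otimes>\<^bsub>pv_free C\<^esub> (q \<odot>\<^bsub>pv_free C\<^esub> W [Gen_Q])
      = q [^] Suc N \<odot>\<^bsub>pv_free C\<^esub> (W [Gen_t] \<otimes>\<^bsub>pv_free C\<^esub> Qpow (Suc N))"
    by (simp add: F.smult_mult_left F.smult_mult_right free_word_mult replicate_append_same
        m_comm flip: F.smult_assoc1)
  finally show ?case .
qed

text \<open>
  If \<open>t\<close> is prepended to a word, \<open>Q\<^sup>N\<close> moves past it at the cost of the scalar \<open>q\<^sup>N\<close>; prepending \<open>Q\<close> keeps \<open>N\<close>;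
  prepending \<open>Q\<^sup>-\<^sup>1\<close> is undone by one more factor \<open>Q\<close>.
\<close>

lemma normal_form_word: "\<exists>N. \<exists>z \<in> normal_elements. coset (Qpow N \<otimes>\<^bsub>pv_free C\<^esub> W w) = coset z"
proof (induction w)
  case Nil
  have "Qpow 0 \<otimes>\<^bsub>pv_free C\<^esub> W [] = W (normal_word 0 0)"
    by (simp add: free_word_mult normal_word_0)
  then show ?case
    using normal_elements_word[OF normal_word_in] by metis
next
  case (Cons x w)
  then obtain N z where z: "z \<in> normal_elements" "coset (Qpow N \<otimes>\<^bsub>pv_free C\<^esub> W w) = coset z"
    by blast
  note zF = normal_elements_closed[OF z(1)]
  show ?case
  proof (cases x)
    case Gen_t
    have "coset (Qpow N \<otimes>\<^bsub>pv_free C\<^esub> W (x # w)) = coset ((Qpow N \<otimes>\<^bsub>pv_free C\<^esub> W [Gen_t]) \<otimes>\<^bsub>pv_free C\<^esub> W w)"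
      using Gen_t by (simp add: free_word_mult)
    also have "\<dots> = coset ((q [^] N \<odot>\<^bsub>pv_free C\<^esub> (W [Gen_t] \<otimes>\<^bsub>pv_free C\<^esub> Qpow N)) \<otimes>\<^bsub>pv_free C\<^esub> W w)"
      by (rule coset_mult) (simp_all add: coset_Qpow_t)
    also have "\<dots> = coset ((q [^] N \<odot>\<^bsub>pv_free C\<^esub> W [Gen_t]) \<otimes>\<^bsub>pv_free C\<^esub> (Qpow N \<otimes>\<^bsub>pv_free C\<^esub> W w))"
      by (simp add: F.smult_mult_left free_word_mult)
    also have "\<dots> = coset ((q [^] N \<odot>\<^bsub>pv_free C\<^esub> W [Gen_t]) \<otimes>\<^bsub>pv_free C\<^esub> z)"
      using z zF by (intro coset_mult) simp_all
    finally have 1: "coset (Qpow N \<otimes>\<^bsub>pv_free C\<^esub> W (x # w)) = coset (q [^] N \<odot>\<^bsub>pv_free C\<^esub> (W [Gen_t] \<otimes>\<^bsub>pv_free C\<^esub> z))"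
      using zF by (simp add: F.smult_mult_left)
    obtain z' where z': "z' \<in> normal_elements" "coset (W [Gen_t] \<otimes>\<^bsub>pv_free C\<^esub> z) = coset z'"
      using normal_t_mult[OF z(1)] by blast
    have "coset (q [^] N \<odot>\<^bsub>pv_free C\<^esub> (W [Gen_t] \<otimes>\<^bsub>pv_free C\<^esub> z)) = coset (q [^] N \<odot>\<^bsub>pv_free C\<^esub> z')"
      using z' zF by (intro coset_smult) (simp_all add: normal_elements_closed)
    then show ?thesis
      using 1 z' by (intro exI[of _ N] bexI[of _ "q [^] N \<odot>\<^bsub>pv_free C\<^esub> z'"] normal_elements_smult) simp_all
  next
    case Gen_Q
    have "coset (Qpow N \<otimes>\<^bsub>pv_free C\<^esub> W (x # w)) = coset (W [Gen_Q] \<otimes>\<^bsub>pv_free C\<^esub> (Qpow N \<otimes>\<^bsub>pv_free C\<^esub> W w))"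
      using Gen_Q by (simp add: free_word_mult replicate_app_Cons_same)
    also have "\<dots> = coset (W [Gen_Q] \<otimes>\<^bsub>pv_free C\<^esub> z)"
      using z zF by (intro coset_mult) simp_all
    finally show ?thesis
      using normal_Q_mult[OF z(1)] by metis
  next
    case Gen_Qinv
    have "coset (Qpow (Suc N) \<otimes>\<^bsub>pv_free C\<^esub> W (x # w)) = coset (Qpow N \<otimes>\<^bsub>pv_free C\<^esub> (W [Gen_Q, Gen_Qinv] \<otimes>\<^bsub>pv_free C\<^esub> W w))"
      using Gen_Qinv by (simp add: free_word_mult replicate_app_Cons_same)
    also have "\<dots> = coset (Qpow N \<otimes>\<^bsub>pv_free C\<^esub> (\<one>\<^bsub>pv_free C\<^esub> \<otimes>\<^bsub>pv_free C\<^esub> W w))"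
      by (intro coset_mult) (simp_all add: coset_Q_Qi)
    finally show ?thesis
      using z by (intro exI[of _ "Suc N"] bexI[of _ z]) simp_all
  qed
qed

text \<open>
  Different words may need different powers of \<open>Q\<close>. A sum is multiplied by the product of the two
  powers, and the span of the normal words is closed under left multiplication by \<open>Q\<close>.
\<close>

lemma normal_form:
  assumes "x \<in> carrier (pv_free C)"
  shows "\<exists>N. \<exists>z \<in> normal_elements. coset (Qpow N \<otimes>\<^bsub>pv_free C\<^esub> x) = coset z"
  using assms subset_UNIV
proof (induction x rule: free_algebra_induct)
  case zero
  have "coset (Qpow 0 \<otimes>\<^bsub>pv_free C\<^esub> \<zero>\<^bsub>pv_free C\<^esub>) = coset \<zero>\<^bsub>pv_free C\<^esub>"
    by (simp del: replicate.simps)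
  then show ?case
    using normal_elements_zero by blast
next
  case (add f c w)
  then obtain N z where z: "z \<in> normal_elements" "coset (Qpow N \<otimes>\<^bsub>pv_free C\<^esub> f) = coset z"
    by blast
  obtain M y where y: "y \<in> normal_elements" "coset (Qpow M \<otimes>\<^bsub>pv_free C\<^esub> W w) = coset y"
    using normal_form_word by blast
  obtain z' where z': "z' \<in> normal_elements" "coset (Qpow M \<otimes>\<^bsub>pv_free C\<^esub> z) = coset z'"
    using normal_Qpow_mult[OF z(1)] by blast
  obtain y' where y': "y' \<in> normal_elements" "coset (Qpow N \<otimes>\<^bsub>pv_free C\<^esub> y) = coset y'"
    using normal_Qpow_mult[OF y(1)] by blast
  note mem = z(1)[THEN normal_elements_closed] y(1)[THEN normal_elements_closed]
    z'(1)[THEN normal_elements_closed] y'(1)[THEN normal_elements_closed]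
  have NM: "Qpow (M + N) = Qpow M \<otimes>\<^bsub>pv_free C\<^esub> Qpow N" "Qpow (M + N) = Qpow N \<otimes>\<^bsub>pv_free C\<^esub> Qpow M"
    by (simp_all add: free_word_mult add.commute flip: replicate_add)
  have "coset (Qpow M \<otimes>\<^bsub>pv_free C\<^esub> (Qpow N \<otimes>\<^bsub>pv_free C\<^esub> f)) = coset z'"
    using coset_mult[OF refl z(2), of "Qpow M"] z'(2) mem add.hyps by simp
  then have 1: "coset (Qpow (M + N) \<otimes>\<^bsub>pv_free C\<^esub> f) = coset z'"
    using add.hyps unfolding NM(1) by (simp add: F.m_assoc)
  have "coset (Qpow N \<otimes>\<^bsub>pv_free C\<^esub> (Qpow M \<otimes>\<^bsub>pv_free C\<^esub> W w)) = coset y'"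
    using coset_mult[OF refl y(2), of "Qpow N"] y'(2) mem by simp
  then have "coset (Qpow (M + N) \<otimes>\<^bsub>pv_free C\<^esub> W w) = coset y'"
    unfolding NM(2) by (simp add: F.m_assoc)
  then have 2: "coset (c \<odot>\<^bsub>pv_free C\<^esub> (Qpow (M + N) \<otimes>\<^bsub>pv_free C\<^esub> W w)) = coset (c \<odot>\<^bsub>pv_free C\<^esub> y')"
    using add.hyps mem by (intro coset_smult) simp_all
  have "coset (Qpow (M + N) \<otimes>\<^bsub>pv_free C\<^esub> f \<oplus>\<^bsub>pv_free C\<^esub> c \<odot>\<^bsub>pv_free C\<^esub> (Qpow (M + N) \<otimes>\<^bsub>pv_free C\<^esub> W w))
      = coset (z' \<oplus>\<^bsub>pv_free C\<^esub> c \<odot>\<^bsub>pv_free C\<^esub> y')"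
    using 1 2 add.hyps mem by (intro coset_add) simp_all
  then show ?case
    using z' y' add.hyps
    by (intro exI[of _ "M + N"] bexI[of _ "z' \<oplus>\<^bsub>pv_free C\<^esub> c \<odot>\<^bsub>pv_free C\<^esub> y'"]
        normal_elements_add normal_elements_smult)
      (simp_all add: F.r_distr F.smult_mult_right)
qed

text \<open>
  Modulo the ideal \<open>Qi\<close> is a left inverse of \<open>Q\<close>, so that factors \<open>Q\<close> on the left can be removed one
  by one.
\<close>

lemma Qpow_cancel:
  assumes "x \<in> carrier (pv_free C)" "Qpow N \<otimes>\<^bsub>pv_free C\<^esub> x \<in> pv_ideal C q"
  shows "x \<in> pv_ideal C q"
  using assms(2)
proof (induction N)
  case 0
  then show ?case
    using assms(1) by (simp flip: free_one_word)
next
  case (Suc N)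
  let ?y = "Qpow N \<otimes>\<^bsub>pv_free C\<^esub> x"
  have y: "?y \<in> carrier (pv_free C)"
    using assms(1) by simp
  have "Qpow (Suc N) \<otimes>\<^bsub>pv_free C\<^esub> x = W [Gen_Q] \<otimes>\<^bsub>pv_free C\<^esub> ?y"
    using assms(1) by (simp only: Qpow_Suc) (simp add: F.m_assoc)
  then have "coset (W [Gen_Qinv] \<otimes>\<^bsub>pv_free C\<^esub> (W [Gen_Q] \<otimes>\<^bsub>pv_free C\<^esub> ?y)) = pv_ideal C q"
    using Suc.prems by (intro I.a_rcos_const[OF I.I_l_closed]) (simp_all only: W_closed)
  moreover have "W [Gen_Qinv] \<otimes>\<^bsub>pv_free C\<^esub> (W [Gen_Q] \<otimes>\<^bsub>pv_free C\<^esub> ?y) = W [Gen_Qinv, Gen_Q] \<otimes>\<^bsub>pv_free C\<^esub> ?y"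
    using assms(1) by (simp add: free_word_mult flip: F.m_assoc)
  moreover have "coset (W [Gen_Qinv, Gen_Q] \<otimes>\<^bsub>pv_free C\<^esub> ?y) = coset (\<one>\<^bsub>pv_free C\<^esub> \<otimes>\<^bsub>pv_free C\<^esub> ?y)"
    using assms(1) by (intro coset_mult) (simp_all add: coset_Qi_Q)
  ultimately have "coset ?y = pv_ideal C q"
    using y by simp
  then have "?y \<in> pv_ideal C q"
    by (rule I.rcos_const_imp_mem[OF y])
  then show ?case
    by (rule Suc.IH)
qed

end

section \<open>Independence of the monomials and the kernel of evaluation\<close>

lemma count_list_normal_word: "count_list (normal_word i n) Gen_t = i"
proof -
  have "count_list (replicate n Gen_Q) Gen_t = 0"
    by (induction n) auto
  then show ?thesis
    by (induction i) (simp_all add: normal_word_0 normal_word_Suc)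
qed

sublocale q_skew_triple \<subseteq> q_plane_presentation C q
  by unfold_locales simp

context q_skew_triple
begin

definition gen :: "pv_gen \<Rightarrow> 'a" where
  "gen x = (case x of Gen_t \<Rightarrow> t | Gen_Q \<Rightarrow> Q | Gen_Qinv \<Rightarrow> Qi)"

lemma gen_simps [simp]: "gen Gen_t = t" "gen Gen_Q = Q" "gen Gen_Qinv = Qi"
  by (simp_all add: gen_def)

lemma gen_closed [simp]: "gen x \<in> carrier A"
  by (cases x) simp_all

abbreviation ev :: "(pv_gen list \<Rightarrow> 'c) \<Rightarrow> 'a" where
  "ev \<equiv> evaluation C A gen"

abbreviation val :: "pv_gen list \<Rightarrow> 'a" where
  "val \<equiv> word_value A gen"

lemma val_closed [simp]: "val w \<in> carrier A"
  by (simp add: word_value_closed)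

lemma ev_word [simp]: "ev (W w) = val w"
  by (simp add: evaluation_word)

lemma ev_linear: "linear_map C (pv_free C) A ev"
  by (simp add: evaluation_linear)

sublocale ev: ring_hom_ring "pv_free C" A ev
  by (simp add: evaluation_hom)

lemma ev_smult: "\<lbrakk>c \<in> carrier C; x \<in> carrier (pv_free C)\<rbrakk> \<Longrightarrow> ev (c \<odot>\<^bsub>pv_free C\<^esub> x) = c \<odot> ev x"
  using ev_linear by (simp add: linear_map_def)

text \<open>
  The values on \<open>Qi\<close>, here and in \<open>theta_Qi\<close>, result from applying the operators to \<open>Q Qi = 1\<close>.
\<close>

lemma sigma_Qi: "qsigma A Qi = inv\<^bsub>C\<^esub> q \<odot> Qi"
proof -
  have "q \<odot> (Q \<otimes> qsigma A Qi) = qsigma A (Q \<otimes> Qi)"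
    by (simp only: sigma.hom_mult triple_closed) (simp add: sigma_Q smult_mult_left)
  then have "q \<odot> (Q \<otimes> qsigma A Qi) = \<one>"
    by (simp add: Q_Qi)
  then have "(inv\<^bsub>C\<^esub> q \<odot> Qi) \<otimes> (q \<odot> (Q \<otimes> qsigma A Qi)) = inv\<^bsub>C\<^esub> q \<odot> Qi"
    by simp
  moreover have "(inv\<^bsub>C\<^esub> q \<odot> Qi) \<otimes> (q \<odot> (Q \<otimes> qsigma A Qi)) = (inv\<^bsub>C\<^esub> q \<otimes>\<^bsub>C\<^esub> q) \<odot> ((Qi \<otimes> Q) \<otimes> qsigma A Qi)"
    by (simp add: smult_mult_left smult_mult_right m_assoc R.m_comm flip: smult_assoc1)
  ultimately show ?thesis
    using q_Units by (simp add: Qi_Q)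
qed

lemma theta_Qi: "qtheta A 1 Qi = \<zero>"
proof -
  have closed: "qtheta A 1 Qi \<in> carrier A"
    by (rule theta_closed) simp
  have "q \<odot> (Q \<otimes> qtheta A 1 Qi) = qtheta A 1 (Q \<otimes> Qi)"
    using closed by (simp add: theta1_mult theta_Q sigma_Q smult_mult_left del: One_nat_def)
  then have eq: "q \<odot> (Q \<otimes> qtheta A 1 Qi) = \<zero>"
    by (simp only: Q_Qi theta1_one)
  have "qtheta A 1 Qi = (inv\<^bsub>C\<^esub> q \<otimes>\<^bsub>C\<^esub> q) \<odot> ((Qi \<otimes> Q) \<otimes> qtheta A 1 Qi)"
    using closed q_Units by (simp add: Qi_Q del: One_nat_def)
  also have "\<dots> = (inv\<^bsub>C\<^esub> q \<odot> Qi) \<otimes> (q \<odot> (Q \<otimes> qtheta A 1 Qi))"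
    using closed by (simp add: smult_mult_left smult_mult_right m_assoc R.m_comm del: One_nat_def
        flip: smult_assoc1)
  finally show ?thesis
    by (simp only: eq) simp
qed

lemma sigma_normal_word:
  "qsigma A (val (normal_word i n)) = q [^]\<^bsub>C\<^esub> (i + n) \<odot> val (normal_word i n)"
proof (induction i)
  case 0
  show ?case
    by (induction n)
      (simp_all add: normal_word_0 sigma_Q smult_mult_left smult_mult_right R.m_comm
        flip: smult_assoc1)
next
  case (Suc i)
  then show ?case
    by (simp add: normal_word_Suc sigma_t smult_mult_left smult_mult_right R.m_comm
        flip: smult_assoc1)
qed

lemma theta_normal_word_0: "qtheta A 1 (val (normal_word 0 n)) = \<zero>"
  by (induction n)
    (simp_all add: normal_word_0 theta1_one theta1_mult theta_Q sigma_Q del: One_nat_def)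

lemma theta_normal_word_Suc:
  "qtheta A 1 (val (normal_word (Suc i) n)) = q_int C q (Suc i) \<odot> val (normal_word i n)"
proof (induction i)
  case 0
  show ?case
    using theta_normal_word_0[of n]
    by (simp add: normal_word_Suc theta1_mult theta_t sigma_t R.q_int_Suc R.q_int_0 del: One_nat_def)
next
  case (Suc i)
  have "qtheta A 1 (val (normal_word (Suc (Suc i)) n))
      = val (normal_word (Suc i) n) \<oplus> (q \<odot> t) \<otimes> (q_int C q (Suc i) \<odot> val (normal_word i n))"
    using Suc by (simp add: normal_word_Suc[of "Suc i"] theta1_mult theta_t sigma_t del: One_nat_def)
  also have "\<dots> = (\<one>\<^bsub>C\<^esub> \<oplus>\<^bsub>C\<^esub> q \<otimes>\<^bsub>C\<^esub> q_int C q (Suc i)) \<odot> val (normal_word (Suc i) n)"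
    by (simp add: normal_word_Suc smult_mult_left smult_mult_right smult_l_distr R.m_comm
        flip: smult_assoc1)
  finally show ?case
    by (simp only: R.q_int_Suc'[OF q_closed])
qed

lemma val_normal_word_0_nonzero: "val (normal_word 0 n) \<noteq> \<zero>"
proof (induction n)
  case 0
  then show ?case
    using nontrivial by (simp add: normal_word_0)
next
  case (Suc n)
  have "val (normal_word 0 n) = Qi \<otimes> val (normal_word 0 (Suc n))"
    by (simp add: normal_word_0 Qi_Q flip: m_assoc)
  then show ?case
    using Suc by auto
qed

lemma smult_eq_zero:
  assumes "c \<in> carrier C" "x \<in> carrier A" "c \<odot> x = \<zero>" "x \<noteq> \<zero>"
  shows "c = \<zero>\<^bsub>C\<^esub>"
proof (rule ccontr)
  assume "c \<noteq> \<zero>\<^bsub>C\<^esub>"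
  then have "c \<in> Units C"
    using assms(1) by (simp add: C.field_Units)
  then have "x = inv\<^bsub>C\<^esub> c \<odot> (c \<odot> x)"
    using assms(1,2) by (simp flip: smult_assoc1)
  then show False
    using assms(3,4) \<open>c \<in> Units C\<close> by simp
qed

lemma q_pow_inj: "m < n \<Longrightarrow> q [^]\<^bsub>C\<^esub> m \<noteq> q [^]\<^bsub>C\<^esub> n" for m n :: nat
proof
  assume "m < n" and eq: "q [^]\<^bsub>C\<^esub> m = q [^]\<^bsub>C\<^esub> n"
  have "q [^]\<^bsub>C\<^esub> m \<otimes>\<^bsub>C\<^esub> q [^]\<^bsub>C\<^esub> (n - m) = q [^]\<^bsub>C\<^esub> m \<otimes>\<^bsub>C\<^esub> \<one>\<^bsub>C\<^esub>"
    using \<open>m < n\<close> R.nat_pow_mult[OF q_closed, of m "n - m"] by (simp flip: eq)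
  moreover have "q [^]\<^bsub>C\<^esub> m \<noteq> \<zero>\<^bsub>C\<^esub>"
    using R.Units_pow_closed[OF q_Units, of m] by (simp add: C.field_Units)
  ultimately have "q [^]\<^bsub>C\<^esub> (n - m) = \<one>\<^bsub>C\<^esub>"
    using C.m_lcancel[of "q [^]\<^bsub>C\<^esub> m" "q [^]\<^bsub>C\<^esub> (n - m)" "\<one>\<^bsub>C\<^esub>"] by simp
  then show False
    using q_not_root \<open>m < n\<close> by auto
qed

text \<open>
  The operator \<open>\<sigma> - q\<^sup>m\<close> kills \<open>Q\<^sup>m\<close> and multiplies the coefficient of \<open>Q\<^sup>n\<close> by \<open>q\<^sup>n - q\<^sup>m \<noteq> 0\<close> for
  \<open>n < m\<close>. On coefficient functions it is the operator \<open>D\<close>, to which the induction hypothesis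
  applies.
\<close>

lemma Q_powers_independent:
  assumes "f \<in> carrier (pv_free C)" "{w. f w \<noteq> \<zero>\<^bsub>C\<^esub>} \<subseteq> normal_word 0 ` {..<m}" "ev f = \<zero>"
  shows "f w = \<zero>\<^bsub>C\<^esub>"
  using assms
proof (induction m arbitrary: f w)
  case 0
  then show ?case
    by auto
next
  case (Suc m)
  define D where "D = (\<lambda>(f :: pv_gen list \<Rightarrow> 'c) w. (q [^]\<^bsub>C\<^esub> length w \<ominus>\<^bsub>C\<^esub> q [^]\<^bsub>C\<^esub> m) \<otimes>\<^bsub>C\<^esub> f w)"
  have D: "linear_map C (pv_free C) (pv_free C) D"
    unfolding D_def by (rule R.weighted_shift_linear) simp_all
  have T: "linear_map C A A (\<lambda>x. qsigma A x \<oplus> (\<ominus>\<^bsub>C\<^esub> (q [^]\<^bsub>C\<^esub> m)) \<odot> x)"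
    by (simp add: linear_map_def sigma_smult smult_r_distr a_ac R.m_comm flip: smult_assoc1)
  have "ev (D f) = qsigma A (ev f) \<oplus> (\<ominus>\<^bsub>C\<^esub> (q [^]\<^bsub>C\<^esub> m)) \<odot> ev f"
  proof (rule linear_map_eqI[OF linear_map_comp[OF D ev_linear] linear_map_comp[OF ev_linear T]
        Suc.prems(1,2)])
    fix w assume "w \<in> normal_word 0 ` {..<Suc m}"
    then obtain n where w: "w = normal_word 0 n"
      by blast
    have "D (W w) = (q [^]\<^bsub>C\<^esub> n \<ominus>\<^bsub>C\<^esub> q [^]\<^bsub>C\<^esub> m) \<odot>\<^bsub>pv_free C\<^esub> W w"
      by (auto simp: D_def R.free_smult_apply free_word_def w normal_word_0)
    then show "ev (D (W w)) = qsigma A (ev (W w)) \<oplus> (\<ominus>\<^bsub>C\<^esub> (q [^]\<^bsub>C\<^esub> m)) \<odot> ev (W w)"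
      using sigma_normal_word[of 0 n] by (simp add: ev_smult w smult_l_distr R.minus_eq)
  qed
  then have "ev (D f) = \<zero>"
    using Suc.prems(3) by simp
  moreover have "D f \<in> carrier (pv_free C)"
    using D Suc.prems(1) by (simp add: linear_map_def)
  moreover have "{w. D f w \<noteq> \<zero>\<^bsub>C\<^esub>} \<subseteq> normal_word 0 ` {..<m}"
  proof
    fix w assume w: "w \<in> {w. D f w \<noteq> \<zero>\<^bsub>C\<^esub>}"
    then have "f w \<noteq> \<zero>\<^bsub>C\<^esub>"
      by (auto simp: D_def)
    then obtain n where n: "n < Suc m" "w = normal_word 0 n"
      using Suc.prems(2) by auto
    moreover have "n \<noteq> m"
      using w n R.free_algebra_memD(1)[OF Suc.prems(1)]
      by (auto simp: D_def normal_word_0 R.r_neg R.minus_eq)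
    ultimately show "w \<in> normal_word 0 ` {..<m}"
      by auto
  qed
  ultimately have Df: "D f w = \<zero>\<^bsub>C\<^esub>" for w
    by (intro Suc.IH)
  have lower: "f w = \<zero>\<^bsub>C\<^esub>" if w: "w \<noteq> normal_word 0 m" for w
  proof (rule ccontr)
    assume nz: "f w \<noteq> \<zero>\<^bsub>C\<^esub>"
    then have "w \<in> normal_word 0 ` {..<Suc m}"
      using Suc.prems(2) by blast
    then obtain n where n: "n < m" "w = normal_word 0 n"
      using w by (auto simp: less_Suc_eq)
    have "q [^]\<^bsub>C\<^esub> n \<ominus>\<^bsub>C\<^esub> q [^]\<^bsub>C\<^esub> m = \<zero>\<^bsub>C\<^esub>"
      using Df[of w] nz R.free_algebra_memD(1)[OF Suc.prems(1)] n
        C.integral[of "q [^]\<^bsub>C\<^esub> n \<ominus>\<^bsub>C\<^esub> q [^]\<^bsub>C\<^esub> m" "f w"]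
      by (simp add: D_def normal_word_0)
    then show False
      using q_pow_inj[OF n(1)] by simp
  qed
  have top: "f (normal_word 0 m) = \<zero>\<^bsub>C\<^esub>"
  proof -
    have "f = f (normal_word 0 m) \<odot>\<^bsub>pv_free C\<^esub> W (normal_word 0 m)"
      using lower R.free_algebra_memD(1)[OF Suc.prems(1)]
      by (auto simp: R.free_smult_apply free_word_def)
    then have "f (normal_word 0 m) \<odot> val (normal_word 0 m) = \<zero>"
      using Suc.prems(3) R.free_algebra_memD(1)[OF Suc.prems(1)]
      by (metis W_closed ev_smult ev_word)
    then show ?thesis
      using smult_eq_zero[OF _ val_closed _ val_normal_word_0_nonzero]
        R.free_algebra_memD(1)[OF Suc.prems(1)] by blast
  qed
  show ?case
    using lower top by metis
qed

text \<open>
  Applying \<open>\<theta>\<close> lowers the degree in \<open>t\<close>: the coefficient of \<open>t\<^sup>i Q\<^sup>n\<close> in \<open>\<theta>(f)\<close> is \<open>[i + 1]\<^sub>q\<close> times that of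
  \<open>t\<^sup>i\<^sup>+\<^sup>1 Q\<^sup>n\<close> in \<open>f\<close>, which is what \<open>D\<close> expresses on coefficient functions. By induction these
  coefficients vanish, and only powers of \<open>Q\<close> remain.
\<close>

lemma normal_words_independent_bounded:
  assumes "f \<in> carrier (pv_free C)" "{w. f w \<noteq> \<zero>\<^bsub>C\<^esub>} \<subseteq> {normal_word i n | i n. i < k}" "ev f = \<zero>"
  shows "f w = \<zero>\<^bsub>C\<^esub>"
  using assms
proof (induction k arbitrary: f w)
  case 0
  then show ?case
    by auto
next
  case (Suc k)
  define D where "D = (\<lambda>(f :: pv_gen list \<Rightarrow> 'c) w. q_int C q (Suc (count_list w Gen_t)) \<otimes>\<^bsub>C\<^esub> f (Gen_t # w))"
  have D: "linear_map C (pv_free C) (pv_free C) D"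
    unfolding D_def by (rule R.weighted_shift_linear) simp_all
  have "ev (D f) = qtheta A 1 (ev f)"
  proof (rule linear_map_eqI[OF linear_map_comp[OF D ev_linear]
        linear_map_comp[OF ev_linear theta_linear] Suc.prems(1,2)])
    fix w assume "w \<in> {normal_word i n | i n. i < Suc k}"
    then obtain i n where w: "w = normal_word i n"
      by blast
    show "ev (D (W w)) = qtheta A 1 (ev (W w))"
    proof (cases i)
      case 0
      have "Gen_t # v \<noteq> normal_word 0 n" for v
        by (cases n) (simp_all add: normal_word_0)
      then have "D (W w) = \<zero>\<^bsub>pv_free C\<^esub>"
        by (simp add: D_def fun_eq_iff free_word_def w 0 R.free_zero_apply)
      then show ?thesis
        using w 0 theta_normal_word_0 by simp
    next
      case (Suc j)
      have "D (W w) = q_int C q (Suc j) \<odot>\<^bsub>pv_free C\<^esub> W (normal_word j n)"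
        by (auto simp: D_def free_word_def w Suc R.free_smult_apply normal_word_Suc
            count_list_normal_word)
      then show ?thesis
        using theta_normal_word_Suc[of j n] by (simp add: ev_smult w Suc)
    qed
  qed
  then have "ev (D f) = \<zero>"
    using Suc.prems(3) by (simp add: theta_zero)
  moreover have "D f \<in> carrier (pv_free C)"
    using D Suc.prems(1) by (simp add: linear_map_def)
  moreover have "{w. D f w \<noteq> \<zero>\<^bsub>C\<^esub>} \<subseteq> {normal_word i n | i n. i < k}"
  proof
    fix w assume "w \<in> {w. D f w \<noteq> \<zero>\<^bsub>C\<^esub>}"
    then have "f (Gen_t # w) \<noteq> \<zero>\<^bsub>C\<^esub>"
      by (auto simp: D_def)
    then obtain i n where i: "i < Suc k" "Gen_t # w = normal_word i n"
      using Suc.prems(2) by auto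
    then obtain j where "i = Suc j"
      by (cases i; cases n) (auto simp: normal_word_0)
    then show "w \<in> {normal_word i n | i n. i < k}"
      using i by (auto simp: normal_word_Suc)
  qed
  ultimately have Df: "D f w = \<zero>\<^bsub>C\<^esub>" for w
    by (intro Suc.IH)
  have f_t: "f (Gen_t # w) = \<zero>\<^bsub>C\<^esub>" for w
    using Df[of w] C.q_int_nonzero[OF q_closed q_not_root] C.integral
      R.free_algebra_memD(1)[OF Suc.prems(1)]
    unfolding D_def by (metis R.q_int_closed q_closed zero_less_Suc)
  have Q_only: "\<exists>n. w = normal_word 0 n" if w: "f w \<noteq> \<zero>\<^bsub>C\<^esub>" for w
  proof -
    obtain i n where "w = normal_word i n"
      using Suc.prems(2) w by auto
    then show ?thesis
      using f_t w by (cases i) (auto simp: normal_word_Suc)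
  qed
  have "finite (length ` {w. f w \<noteq> \<zero>\<^bsub>C\<^esub>})"
    using R.free_algebra_memD(2)[OF Suc.prems(1)] by simp
  then obtain m where m: "\<forall>l \<in> length ` {w. f w \<noteq> \<zero>\<^bsub>C\<^esub>}. l < m"
    using finite_nat_set_iff_bounded by auto
  have "{w. f w \<noteq> \<zero>\<^bsub>C\<^esub>} \<subseteq> normal_word 0 ` {..<m}"
  proof
    fix w assume w: "w \<in> {w. f w \<noteq> \<zero>\<^bsub>C\<^esub>}"
    then obtain n where "w = normal_word 0 n"
      using Q_only by blast
    moreover have "length w < m"
      using m w by blast
    ultimately show "w \<in> normal_word 0 ` {..<m}"
      by (simp add: normal_word_0)
  qed
  then show ?case
    by (rule Q_powers_independent[OF Suc.prems(1) _ Suc.prems(3)])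
qed

lemma normal_words_independent:
  assumes "f \<in> normal_elements" "ev f = \<zero>"
  shows "f = \<zero>\<^bsub>pv_free C\<^esub>"
proof -
  have f: "f \<in> carrier (pv_free C)" and supp: "{w. f w \<noteq> \<zero>\<^bsub>C\<^esub>} \<subseteq> normal_words"
    using assms(1) by (simp_all add: normal_elements_def)
  have "finite ((\<lambda>w. count_list w Gen_t) ` {w. f w \<noteq> \<zero>\<^bsub>C\<^esub>})"
    using R.free_algebra_memD(2)[OF f] by simp
  then obtain k where k: "\<forall>l \<in> (\<lambda>w. count_list w Gen_t) ` {w. f w \<noteq> \<zero>\<^bsub>C\<^esub>}. l < k"
    using finite_nat_set_iff_bounded by auto
  have "{w. f w \<noteq> \<zero>\<^bsub>C\<^esub>} \<subseteq> {normal_word i n | i n. i < k}"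
  proof
    fix w assume w: "w \<in> {w. f w \<noteq> \<zero>\<^bsub>C\<^esub>}"
    then obtain i n where "w = normal_word i n"
      using supp by (auto simp: normal_words_def)
    moreover have "count_list w Gen_t < k"
      using k w by blast
    ultimately show "w \<in> {normal_word i n | i n. i < k}"
      by (auto simp: count_list_normal_word)
  qed
  then have "f w = \<zero>\<^bsub>C\<^esub>" for w
    by (rule normal_words_independent_bounded[OF f _ assms(2)])
  then show ?thesis
    by (simp add: fun_eq_iff R.free_zero_apply)
qed

lemma kernel_iff: "x \<in> a_kernel (pv_free C) A ev \<longleftrightarrow> x \<in> carrier (pv_free C) \<and> ev x = \<zero>"
  unfolding a_kernel_def' by (rule mem_Collect_eq)

lemma ideal_le_kernel: "pv_ideal C q \<subseteq> a_kernel (pv_free C) A ev"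
  unfolding pv_ideal_def
proof (rule F.genideal_minimal[OF ev.kernel_is_ideal])
  show "pv_relations C q \<subseteq> a_kernel (pv_free C) A ev"
    using relations_closed
    by (auto simp: kernel_iff pv_relations_def F.minus_eq ev_smult Q_Qi Qi_Q Q_t r_neg)
qed

text \<open>
  If \<open>x\<close> evaluates to zero, so does the normal form of \<open>Q\<^sup>N x\<close>, which therefore has zero coefficients;
  hence \<open>Q\<^sup>N x\<close> lies in the ideal, and so does \<open>x\<close> because \<open>Q\<close> is a unit modulo the ideal.
\<close>

lemma kernel_eq_ideal: "a_kernel (pv_free C) A ev = pv_ideal C q"
proof
  show "a_kernel (pv_free C) A ev \<subseteq> pv_ideal C q"
  proof
    fix x assume "x \<in> a_kernel (pv_free C) A ev"
    then have x: "x \<in> carrier (pv_free C)" "ev x = \<zero>"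
      by (simp_all add: kernel_iff)
    obtain N z where z: "z \<in> normal_elements" "coset (Qpow N \<otimes>\<^bsub>pv_free C\<^esub> x) = coset z"
      using normal_form[OF x(1)] by blast
    have zF: "z \<in> carrier (pv_free C)"
      using z(1) by (rule normal_elements_closed)
    have "Qpow N \<otimes>\<^bsub>pv_free C\<^esub> x \<ominus>\<^bsub>pv_free C\<^esub> z \<in> pv_ideal C q"
      using z(2) x(1) zF F.quotient_eq_iff_same_a_r_cos[OF I.ideal_axioms, of "Qpow N \<otimes>\<^bsub>pv_free C\<^esub> x" z]
      by simp
    then have "ev (Qpow N \<otimes>\<^bsub>pv_free C\<^esub> x \<ominus>\<^bsub>pv_free C\<^esub> z) = \<zero>"
      using ideal_le_kernel by (auto simp: kernel_iff)
    then have "ev z = \<zero>"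
      using x zF by (simp add: F.minus_eq)
    then have "z = \<zero>\<^bsub>pv_free C\<^esub>"
      by (rule normal_words_independent[OF z(1)])
    then have "coset (Qpow N \<otimes>\<^bsub>pv_free C\<^esub> x) = pv_ideal C q"
      using z(2) I.a_rcos_const[of "\<zero>\<^bsub>pv_free C\<^esub>"] by simp
    then have "Qpow N \<otimes>\<^bsub>pv_free C\<^esub> x \<in> pv_ideal C q"
      using x(1) by (intro I.rcos_const_imp_mem) simp_all
    then show "x \<in> pv_ideal C q"
      by (rule Qpow_cancel[OF x(1)])
  qed
qed (rule ideal_le_kernel)

section \<open>Comparison with the Picard-Vessiot ring\<close>

lemma pv_sigma_gen_closed: "pv_sigma_gen C q x \<in> carrier (pv_free C)"
  by (cases x) simp_all

lemma pv_theta_gen_closed: "pv_theta_gen C x \<in> carrier (pv_free C)"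
  by (cases x) simp_all

lemma pv_sigma_word_closed: "pv_sigma_word C q w \<in> carrier (pv_free C)"
  by (induction w) (simp_all add: pv_sigma_gen_closed)

lemma pv_theta_word_closed: "pv_theta_word C q w \<in> carrier (pv_free C)"
  by (induction w) (simp_all add: pv_sigma_gen_closed pv_theta_gen_closed)

lemma ev_sigma_gen: "ev (pv_sigma_gen C q x) = qsigma A (gen x)"
  by (cases x) (simp_all add: ev_smult sigma_Q sigma_t sigma_Qi)

lemma ev_theta_gen: "ev (pv_theta_gen C x) = qtheta A 1 (gen x)"
  by (cases x) (simp_all add: theta_Q theta_t theta_Qi del: One_nat_def)

lemma ev_sigma_word: "ev (pv_sigma_word C q w) = qsigma A (val w)"
  by (induction w) (simp_all add: ev_sigma_gen pv_sigma_gen_closed pv_sigma_word_closed)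

lemma ev_theta_word: "ev (pv_theta_word C q w) = qtheta A 1 (val w)"
proof (induction w)
  case Nil
  then show ?case
    by (simp add: theta1_one del: One_nat_def)
next
  case (Cons x w)
  then show ?case
    by (simp add: ev_sigma_gen ev_theta_gen pv_sigma_gen_closed pv_theta_gen_closed
        pv_theta_word_closed theta1_mult del: One_nat_def)
qed

text \<open>
  Both sides are linear, so it is enough to compare them on words.
\<close>

lemma free_linear_intertwines:
  assumes h: "\<And>w. h w \<in> carrier (pv_free C)" and T: "linear_map C A A T"
    and word: "\<And>w. ev (h w) = T (val w)" and x: "x \<in> carrier (pv_free C)"
  shows "free_linear C h x \<in> carrier (pv_free C)" "ev (free_linear C h x) = T (ev x)"
proof -
  have eq: "free_linear C h = linear_extension C (pv_free C) h"
    by (simp add: fun_eq_iff free_linear_def linear_extension_def)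
  have lin: "linear_map C (pv_free C) (pv_free C) (free_linear C h)"
    unfolding eq using h by (rule F.linear_extension_linear)
  then show "free_linear C h x \<in> carrier (pv_free C)"
    using x by (simp add: linear_map_def)
  show "ev (free_linear C h x) = T (ev x)"
    by (rule linear_map_eqI[OF linear_map_comp[OF lin ev_linear] linear_map_comp[OF ev_linear T]
        x subset_UNIV]) (simp add: eq F.linear_extension_word h word)
qed

definition fibre :: "'a \<Rightarrow> (pv_gen list \<Rightarrow> 'c) set" where
  "fibre a = {x \<in> carrier (pv_free C). ev x = a}"

lemma coset_eq_fibre: "x \<in> carrier (pv_free C) \<Longrightarrow> coset x = fibre (ev x)"
  using ev.rcos_eq_homeq[of x] by (simp add: kernel_eq_ideal fibre_def)

context
  assumes generates: "\<And>S. \<lbrakk>subring S A; (\<lambda>c. c \<odot> \<one>) ` carrier C \<subseteq> S; {t, Q, Qi} \<subseteq> S\<rbrakk> \<Longrightarrow>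
    carrier A \<subseteq> S"
begin

lemma ev_surj:
  assumes "a \<in> carrier A"
  obtains x where "x \<in> carrier (pv_free C)" "ev x = a"
proof -
  have "subring (ev ` carrier (pv_free C)) A"
    by (rule ev.img_is_subring[OF F.carrier_is_subring])
  moreover have "c \<odot> \<one> \<in> ev ` carrier (pv_free C)" if "c \<in> carrier C" for c
    using that by (intro image_eqI[of _ _ "c \<odot>\<^bsub>pv_free C\<^esub> \<one>\<^bsub>pv_free C\<^esub>"]) (simp_all add: ev_smult)
  moreover have "gen g \<in> ev ` carrier (pv_free C)" for g
    by (intro image_eqI[of _ _ "W [g]"]) simp_all
  from this[of Gen_t] this[of Gen_Q] this[of Gen_Qinv]
  have "{t, Q, Qi} \<subseteq> ev ` carrier (pv_free C)"
    by simp
  ultimately have "carrier A \<subseteq> ev ` carrier (pv_free C)"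
    using generates by blast
  then show ?thesis
    using assms that by blast
qed

text \<open>
  The ideal is the kernel of the evaluation, so any \<open>p\<close> that descends to a map on \<open>A\<close> respects
  its cosets.
\<close>

lemma coset_map_fibre:
  assumes "a \<in> carrier A"
    and "\<And>x. x \<in> carrier (pv_free C) \<Longrightarrow> p x \<in> carrier (pv_free C)"
    and "\<And>x. x \<in> carrier (pv_free C) \<Longrightarrow> ev (p x) = T (ev x)"
  shows "coset_map (pv_free C) (pv_ideal C q) p (fibre a) = fibre (T a)"
proof -
  obtain x where x: "x \<in> carrier (pv_free C)" "ev x = a"
    using ev_surj[OF assms(1)] .
  have "coset (p y) = fibre (T a)" if "y \<in> fibre a" for y
    using that assms(2,3) by (simp add: fibre_def[of a] coset_eq_fibre)
  moreover have "x \<in> fibre a"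
    using x by (simp add: fibre_def)
  ultimately show ?thesis
    unfolding coset_map_def by blast
qed

lemma pv_smult_fibre:
  "\<lbrakk>c \<in> carrier C; a \<in> carrier A\<rbrakk> \<Longrightarrow> pv_smult C q c (fibre a) = fibre (c \<odot> a)"
  unfolding pv_smult_def by (rule coset_map_fibre) (simp_all add: ev_smult)

lemma pv_sigma_fibre: "a \<in> carrier A \<Longrightarrow> pv_sigma C q (fibre a) = fibre (qsigma A a)"
  unfolding pv_sigma_def
  by (rule coset_map_fibre)
    (simp_all add: free_linear_intertwines[OF pv_sigma_word_closed sigma_linear ev_sigma_word])

lemma pv_theta1_fibre: "a \<in> carrier A \<Longrightarrow> pv_theta1 C q (fibre a) = fibre (qtheta A 1 a)"
  unfolding pv_theta1_def
  by (rule coset_map_fibre)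
    (simp_all add: free_linear_intertwines[OF pv_theta_word_closed theta_linear ev_theta_word]
      del: One_nat_def)

lemma pv_theta1_iterate_fibre:
  assumes "a \<in> carrier A"
  shows "(pv_theta1 C q ^^ m) (fibre a) = fibre ((qtheta A 1 ^^ m) a)"
proof (induction m)
  case (Suc m)
  have "(qtheta A 1 ^^ m) a \<in> carrier A"
    using assms by (simp add: theta1_iterate theta_closed del: One_nat_def)
  then show ?case
    using Suc by (simp add: pv_theta1_fibre del: One_nat_def)
qed simp

lemma pv_ring_simps:
  "carrier (pv_ring C q) = a_rcosets\<^bsub>pv_free C\<^esub> pv_ideal C q"
  "mult (pv_ring C q) = rcoset_mult (pv_free C) (pv_ideal C q)"
  "one (pv_ring C q) = coset \<one>\<^bsub>pv_free C\<^esub>"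
  "add (pv_ring C q) = set_add (pv_free C)"
  "smult (pv_ring C q) = pv_smult C q"
  "qsigma (pv_ring C q) = pv_sigma C q"
  "qtheta (pv_ring C q) m X = pv_smult C q (inv\<^bsub>C\<^esub> (q_fact C q m)) ((pv_theta1 C q ^^ m) X)"
  by (simp_all add: pv_ring_def ring.defs FactRing_def)

lemma qsi_isomorphic_pv_ring: "qsi_isomorphic C A (pv_ring C q)"
proof -
  have cosets: "fibre a \<in> carrier (pv_ring C q)" if a: "a \<in> carrier A" for a
  proof -
    obtain x where "x \<in> carrier (pv_free C)" "ev x = a"
      using ev_surj[OF a] .
    then show ?thesis
      using F.a_rcosetsI[OF I.a_subset, of x] by (simp add: pv_ring_simps coset_eq_fibre)
  qed
  have hom: "fibre \<in> ring_hom A (pv_ring C q)"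
  proof (rule ring_hom_memI)
    fix a b assume "a \<in> carrier A" "b \<in> carrier A"
    then obtain x y where xy: "x \<in> carrier (pv_free C)" "ev x = a" "y \<in> carrier (pv_free C)" "ev y = b"
      using ev_surj by metis
    show "fibre (a \<otimes> b) = fibre a \<otimes>\<^bsub>pv_ring C q\<^esub> fibre b"
      using I.rcoset_mult_add[of x y] xy by (simp add: pv_ring_simps coset_eq_fibre)
    show "fibre (a \<oplus> b) = fibre a \<oplus>\<^bsub>pv_ring C q\<^esub> fibre b"
      using I.a_rcos_sum[of x y] xy by (simp add: pv_ring_simps coset_eq_fibre)
  next
    show "fibre \<one> = \<one>\<^bsub>pv_ring C q\<^esub>"
      by (simp add: pv_ring_simps coset_eq_fibre)
  qed (rule cosets)
  have "bij_betw fibre (carrier A) (carrier (pv_ring C q))"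
    unfolding bij_betw_def
  proof
    show "inj_on fibre (carrier A)"
    proof (rule inj_onI)
      fix a b assume "a \<in> carrier A" "fibre a = fibre b"
      moreover then obtain x where "x \<in> carrier (pv_free C)" "ev x = a"
        using ev_surj by metis
      ultimately have "x \<in> fibre b" "ev x = a"
        by (auto simp: fibre_def)
      then show "a = b"
        by (simp add: fibre_def)
    qed
    show "fibre ` carrier A = carrier (pv_ring C q)"
    proof
      show "carrier (pv_ring C q) \<subseteq> fibre ` carrier A"
      proof
        fix X assume "X \<in> carrier (pv_ring C q)"
        then obtain x where x: "x \<in> carrier (pv_free C)" "X = coset x"
          unfolding pv_ring_simps A_RCOSETS_def' by blast
        then have "X = fibre (ev x)"
          by (simp only: coset_eq_fibre)
        then show "X \<in> fibre ` carrier A"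
          using ev.hom_closed[OF x(1)] by blast
      qed
    qed (auto simp: cosets)
  qed
  then have iso: "fibre \<in> ring_iso A (pv_ring C q)"
    using hom by (simp add: ring_iso_def)
  have smult: "fibre (c \<odot> a) = c \<odot>\<^bsub>pv_ring C q\<^esub> fibre a" if "c \<in> carrier C" "a \<in> carrier A" for c a
    using that by (simp add: pv_ring_simps pv_smult_fibre)
  have sigma: "fibre (qsigma A a) = qsigma (pv_ring C q) (fibre a)" if "a \<in> carrier A" for a
    using that by (simp add: pv_ring_simps pv_sigma_fibre)
  have theta: "fibre (qtheta A i a) = qtheta (pv_ring C q) i (fibre a)" if a: "a \<in> carrier A" for i a
  proof -
    have "(qtheta A 1 ^^ i) a \<in> carrier A"
      using a by (simp add: theta1_iterate theta_closed del: One_nat_def)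
    then show ?thesis
      using a q_fact_Units[of i]
      by (simp add: pv_ring_simps pv_theta1_iterate_fibre pv_smult_fibre theta_eq_iterate
          del: One_nat_def)
  qed
  show ?thesis
    unfolding qsi_isomorphic_def by (intro bexI[OF _ iso] conjI ballI allI smult sigma theta)
qed

end

end

theorem theorem10p8:
  fixes C :: "('c, 'k) ring_scheme" and q :: 'c and A :: "('c, 'a, 'm) qsi_scheme"
  assumes "field C"
    and char_0: "\<forall>n::nat. n > 0 \<longrightarrow> [n] \<cdot>\<^bsub>C\<^esub> \<one>\<^bsub>C\<^esub> \<noteq> \<zero>\<^bsub>C\<^esub>"
    and "q \<in> carrier C" and "q \<noteq> \<zero>\<^bsub>C\<^esub>"
    and not_root_of_unity: "\<forall>n::nat. n > 0 \<longrightarrow> q [^]\<^bsub>C\<^esub> n \<noteq> \<one>\<^bsub>C\<^esub>"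
    and "qsi_algebra C q A"
    and "\<exists>Y Y_inv. fundamental_system_M C q A Y Y_inv \<and>
           carrier A = generated_algebra C A (mat2_entries Y \<union> mat2_entries Y_inv)"
    and "qsi_simple A"
    and "has_rational_point C A"
  shows "qsi_isomorphic C A (pv_ring C q)"
proof -
  obtain pt where pt: "pt \<in> ring_hom A C"
      "\<forall>c \<in> carrier C. \<forall>x \<in> carrier A. pt (c \<odot>\<^bsub>A\<^esub> x) = c \<otimes>\<^bsub>C\<^esub> pt x"
    using assms(9) unfolding has_rational_point_def by blast
  interpret P: pointed_simple_qsi_algebra C q A pt
    using assms pt
    by (intro pointed_simple_qsi_algebra.intro generic_qsi_algebra.intro
        generic_qsi_algebra_axioms.intro pointed_simple_qsi_algebra_axioms.intro) auto
  obtain Y Z where fund: "fundamental_system_M C q A Y Z"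
    and gen: "carrier A = generated_algebra C A (mat2_entries Y \<union> mat2_entries Z)"
    using assms(7) by blast
  obtain t Q Qi where triple: "q_skew_triple C q A t Q Qi"
    and entries: "\<And>S. \<lbrakk>subring S A; (\<lambda>c. c \<odot>\<^bsub>A\<^esub> \<one>\<^bsub>A\<^esub>) ` carrier C \<subseteq> S; {t, Q, Qi} \<subseteq> S\<rbrakk> \<Longrightarrow>
      mat2_entries Y \<union> mat2_entries Z \<subseteq> S"
    using P.q_skew_triple_exists[OF fund] by blast
  show ?thesis
  proof (rule q_skew_triple.qsi_isomorphic_pv_ring[OF triple])
    fix S assume S: "subring S A" "(\<lambda>c. c \<odot>\<^bsub>A\<^esub> \<one>\<^bsub>A\<^esub>) ` carrier C \<subseteq> S" "{t, Q, Qi} \<subseteq> S"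
    show "carrier A \<subseteq> S"
      unfolding gen generated_algebra_def
      using S entries[OF S] subringE(1)[OF S(1)] by (intro P.generate_ring_min_subring1) auto
  qed
qed

end
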